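(* For every integer $r\ge 2$, there is a multiply warped product $M=I\times_{h_1}N_1^{r}\times_{h_2}N_2^{r}\times_{h_3}N_3^{r}$ over an open interval $I$, with metric $g=\mathrm{d}s^2+\sum_{i=1}^3 h_i(s)^2g_{N_i}$ and three Einstein fibers of dimension $r$, which has harmonic Weyl tensor and zero radial Weyl curvature $W(\partial_s,\cdot,\cdot,\cdot)=0$, such that: the three warping derivatives $h_1',h_2',h_3'$ are nowhere zero on $I$; the logarithmic derivatives $h_i'/h_i$, $i\in\{1,2,3\}$, are pairwise distinct at every point of $I$; and the Weyl sectional components $W(U_i,U_j,U_i,U_j)$ between distinct fibers ($U_i,U_j$ unit vectors tangent to $N_i,N_j$, $i\neq j$) are nonzero and have both signs.
   Context: Setting: $I$ is a connected open interval with coordinate $s$, each fiber $(N_i,g_{N_i})$ is a connected Riemannian manifold, each $h_i:I\to(0,\infty)$ is smooth. The number of fibers is counted after combining fibers whose warping functions are proportional by a positive constant on $I$, so the $h_i$ are pairwise nonproportional. $W$ is the Weyl tensor as a covariant 4-tensor with the convention $\mathrm{Rm}(X,Y,Z,T)=\langle\nabla_Y\nabla_XZ-\nabla_X\nabla_YZ+\nabla_{[X,Y]}Z,T\rangle$. "Harmonic Weyl tensor" means $\delta W=0$ (divergence-free), which in dimension at least $4$ is equivalent to vanishing of the Cotton tensor. "Einstein" means $\mathrm{Ric}_N=\mu g_N$ with $\mu$ constant. *)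

theory Defs
  imports "HOL-Analysis.Analysis"
begin

section \<open>Smooth functions\<close>

primrec Ck_on :: "nat \<Rightarrow> 'a::real_normed_vector set \<Rightarrow> ('a \<Rightarrow> 'b::real_normed_vector) \<Rightarrow> bool" where
  "Ck_on 0 S f \<longleftrightarrow> continuous_on S f"
| "Ck_on (Suc k) S f \<longleftrightarrow>
     (\<forall>x\<in>S. f differentiable (at x)) \<and>
     (\<forall>v. Ck_on k S (\<lambda>x. frechet_derivative f (at x) v))"

text \<open>Only used for open sets.\<close>

definition smooth_on :: "'a::real_normed_vector set \<Rightarrow> ('a \<Rightarrow> 'b::real_normed_vector) \<Rightarrow> bool" where
  "smooth_on S f \<longleftrightarrow> (\<forall>k. Ck_on k S f)"


section \<open>Riemannian geometry in a coordinate domain\<close>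

text \<open>
  A metric on an open subset of a Euclidean space is given by the bilinear forms \<open>G x\<close>.
  The space itself plays the role of every tangent space, and the elements of
  \<open>Basis\<close> are the coordinate vector fields. The Euclidean inner product is used only to
  read off coordinates.
\<close>

type_synonym 'e metric_field = "'e \<Rightarrow> 'e \<Rightarrow> 'e \<Rightarrow> real"

definition local_metric :: "'e::euclidean_space set \<Rightarrow> 'e metric_field \<Rightarrow> bool" where
  "local_metric S G \<longleftrightarrow>
     (\<forall>u v. smooth_on S (\<lambda>x. G x u v)) \<and>
     (\<forall>x\<in>S. bilinear (G x) \<and> (\<forall>u v. G x u v = G x v u) \<and> (\<forall>u. u \<noteq> 0 \<longrightarrow> G x u u > 0))"

definition sharp :: "'e::euclidean_space metric_field \<Rightarrow> 'e \<Rightarrow> ('e \<Rightarrow> real) \<Rightarrow> 'e" where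
  "sharp G x L = (THE v. \<forall>w. G x v w = L w)"

text \<open>For \<open>a, b \<in> Basis\<close> this is the entry of the inverse matrix of the metric.\<close>

definition cometric :: "'e::euclidean_space metric_field \<Rightarrow> 'e \<Rightarrow> 'e \<Rightarrow> 'e \<Rightarrow> real" where
  "cometric G x a b = sharp G x (\<lambda>w. w \<bullet> b) \<bullet> a"

definition metric_trace :: "'e::euclidean_space metric_field \<Rightarrow> 'e \<Rightarrow> ('e \<Rightarrow> 'e \<Rightarrow> real) \<Rightarrow> real" where
  "metric_trace G x B = (\<Sum>a\<in>Basis. \<Sum>b\<in>Basis. cometric G x a b * B a b)"

text \<open>
  The value at \<open>x\<close> of the Levi-Civita derivative of the constant field \<open>v\<close> in direction \<open>u\<close>
  (Koszul formula).
\<close>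

definition christoffel :: "'e::euclidean_space metric_field \<Rightarrow> 'e \<Rightarrow> 'e \<Rightarrow> 'e \<Rightarrow> 'e" where
  "christoffel G x u v = sharp G x (\<lambda>z.
     (frechet_derivative (\<lambda>y. G y v z) (at x) u
      + frechet_derivative (\<lambda>y. G y u z) (at x) v
      - frechet_derivative (\<lambda>y. G y u v) (at x) z) / 2)"

definition nabla :: "'e::euclidean_space metric_field \<Rightarrow> ('e \<Rightarrow> 'e) \<Rightarrow> ('e \<Rightarrow> 'e) \<Rightarrow> 'e \<Rightarrow> 'e" where
  "nabla G X Y x = frechet_derivative Y (at x) (X x) + christoffel G x (X x) (Y x)"

definition lie_bracket :: "('e::euclidean_space \<Rightarrow> 'e) \<Rightarrow> ('e \<Rightarrow> 'e) \<Rightarrow> 'e \<Rightarrow> 'e" where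
  "lie_bracket X Y x = frechet_derivative Y (at x) (X x) - frechet_derivative X (at x) (Y x)"

definition Rm_field ::
  "'e::euclidean_space metric_field \<Rightarrow> ('e \<Rightarrow> 'e) \<Rightarrow> ('e \<Rightarrow> 'e) \<Rightarrow> ('e \<Rightarrow> 'e) \<Rightarrow> ('e \<Rightarrow> 'e) \<Rightarrow> 'e \<Rightarrow> real" where
  "Rm_field G X Y Z T x =
     G x (nabla G Y (nabla G X Z) x - nabla G X (nabla G Y Z) x + nabla G (lie_bracket X Y) Z x) (T x)"

text \<open>
  The curvature is tensorial, so it may be evaluated at tangent vectors by extending them to
  constant fields. With this sign, \<open>Rm G x u v u v\<close> is the sectional curvature if \<open>u, v\<close>
  are orthonormal, and Ricci is the trace over the first and third argument.
\<close>

definition Rm :: "'e::euclidean_space metric_field \<Rightarrow> 'e \<Rightarrow> 'e \<Rightarrow> 'e \<Rightarrow> 'e \<Rightarrow> 'e \<Rightarrow> real" where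
  "Rm G x u v w z = Rm_field G (\<lambda>_. u) (\<lambda>_. v) (\<lambda>_. w) (\<lambda>_. z) x"

definition Ric :: "'e::euclidean_space metric_field \<Rightarrow> 'e \<Rightarrow> 'e \<Rightarrow> 'e \<Rightarrow> real" where
  "Ric G x v z = metric_trace G x (\<lambda>a b. Rm G x a v b z)"

definition Scal :: "'e::euclidean_space metric_field \<Rightarrow> 'e \<Rightarrow> real" where
  "Scal G x = metric_trace G x (Ric G x)"

definition Weyl :: "'e::euclidean_space metric_field \<Rightarrow> 'e \<Rightarrow> 'e \<Rightarrow> 'e \<Rightarrow> 'e \<Rightarrow> 'e \<Rightarrow> real" where
  "Weyl G x u v w z =
     (let n = real DIM('e) in
      Rm G x u v w z
      - (Ric G x u w * G x v z + Ric G x v z * G x u w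
         - Ric G x u z * G x v w - Ric G x v w * G x u z) / (n - 2)
      + Scal G x * (G x u w * G x v z - G x u z * G x v w) / ((n - 1) * (n - 2)))"

definition nabla_tensor4 ::
  "'e::euclidean_space metric_field \<Rightarrow> ('e \<Rightarrow> 'e \<Rightarrow> 'e \<Rightarrow> 'e \<Rightarrow> 'e \<Rightarrow> real) \<Rightarrow>
   'e \<Rightarrow> 'e \<Rightarrow> 'e \<Rightarrow> 'e \<Rightarrow> 'e \<Rightarrow> 'e \<Rightarrow> real" where
  "nabla_tensor4 G W x e u v w z =
     frechet_derivative (\<lambda>y. W y u v w z) (at x) e
     - W x (christoffel G x e u) v w z - W x u (christoffel G x e v) w z
     - W x u v (christoffel G x e w) z - W x u v w (christoffel G x e z)"

text \<open>
  Up to sign, the symmetries of the Weyl tensor make the choice of the contracted slot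
  immaterial.
\<close>

definition div_Weyl :: "'e::euclidean_space metric_field \<Rightarrow> 'e \<Rightarrow> 'e \<Rightarrow> 'e \<Rightarrow> 'e \<Rightarrow> real" where
  "div_Weyl G x v w z = metric_trace G x (\<lambda>a b. nabla_tensor4 G (Weyl G) x a b v w z)"


section \<open>Riemannian manifolds\<close>

text \<open>
  A manifold with points in \<open>'p\<close>, modelled on the Euclidean space \<open>'e\<close>, together with an atlas
  indexed by the set \<open>cidx M\<close>; the metric is given by its coefficients in each chart.
\<close>

record ('i, 'p, 'e) riem_mfd =
  mtop :: "'p topology"
  cidx :: "'i set"
  cdom :: "'i \<Rightarrow> 'p set"
  cmap :: "'i \<Rightarrow> 'p \<Rightarrow> 'e"
  cmetric :: "'i \<Rightarrow> 'e metric_field"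

definition cimg :: "('i, 'p, 'e) riem_mfd \<Rightarrow> 'i \<Rightarrow> 'e set" where
  "cimg M k = cmap M k ` cdom M k"

definition transition :: "('i, 'p, 'e) riem_mfd \<Rightarrow> 'i \<Rightarrow> 'i \<Rightarrow> 'e \<Rightarrow> 'e" where
  "transition M k l = cmap M l \<circ> inv_into (cdom M k) (cmap M k)"

definition smooth_manifold :: "('i, 'p, 'e::euclidean_space) riem_mfd \<Rightarrow> bool" where
  "smooth_manifold M \<longleftrightarrow>
     Hausdorff_space (mtop M) \<and> second_countable (mtop M) \<and>
     topspace (mtop M) = (\<Union>k\<in>cidx M. cdom M k) \<and>
     (\<forall>k\<in>cidx M. openin (mtop M) (cdom M k) \<and> open (cimg M k) \<and>
        homeomorphic_map (subtopology (mtop M) (cdom M k)) (top_of_set (cimg M k)) (cmap M k)) \<and>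
     (\<forall>k\<in>cidx M. \<forall>l\<in>cidx M. smooth_on (cmap M k ` (cdom M k \<inter> cdom M l)) (transition M k l))"

definition riemannian_manifold :: "('i, 'p, 'e::euclidean_space) riem_mfd \<Rightarrow> bool" where
  "riemannian_manifold M \<longleftrightarrow>
     smooth_manifold M \<and>
     (\<forall>k\<in>cidx M. local_metric (cimg M k) (cmetric M k)) \<and>
     (\<forall>k\<in>cidx M. \<forall>l\<in>cidx M. \<forall>x\<in>cmap M k ` (cdom M k \<inter> cdom M l). \<forall>u v.
        cmetric M k x u v =
        cmetric M l (transition M k l x)
          (frechet_derivative (transition M k l) (at x) u)
          (frechet_derivative (transition M k l) (at x) v))"

text \<open>An empty topology is a connected space, hence the extra condition.\<close>

definition connected_riemannian_manifold :: "('i, 'p, 'e::euclidean_space) riem_mfd \<Rightarrow> bool" where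
  "connected_riemannian_manifold M \<longleftrightarrow>
     riemannian_manifold M \<and> connected_space (mtop M) \<and> topspace (mtop M) \<noteq> {}"

definition einstein :: "('i, 'p, 'e::euclidean_space) riem_mfd \<Rightarrow> bool" where
  "einstein M \<longleftrightarrow>
     (\<exists>\<mu>. \<forall>k\<in>cidx M. \<forall>x\<in>cimg M k. \<forall>u v. Ric (cmetric M k) x u v = \<mu> * cmetric M k x u v)"

definition harmonic_Weyl :: "('i, 'p, 'e::euclidean_space) riem_mfd \<Rightarrow> bool" where
  "harmonic_Weyl M \<longleftrightarrow>
     (\<forall>k\<in>cidx M. \<forall>x\<in>cimg M k. \<forall>v w z. div_Weyl (cmetric M k) x v w z = 0)"


section \<open>Multiply warped products\<close>

text \<open>
  The fibers are indexed by a finite type \<open>'k\<close> and have a common dimension. Points of the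
  product are pairs of a parameter \<open>s \<in> I\<close> and a family of points of the fibers; its charts are
  the products of the identity of \<open>I\<close> with one chart of each fiber.
\<close>

definition multiply_warped_product ::
  "real set \<Rightarrow> ('k::finite \<Rightarrow> real \<Rightarrow> real) \<Rightarrow> ('k \<Rightarrow> ('i, 'p, 'e::euclidean_space) riem_mfd) \<Rightarrow>
   ('k \<Rightarrow> 'i, real \<times> ('k \<Rightarrow> 'p), real \<times> ('e ^ 'k)) riem_mfd" where
  "multiply_warped_product I h N =
     \<lparr> mtop = prod_topology (top_of_set I) (product_topology (\<lambda>i. mtop (N i)) UNIV),
       cidx = {c. \<forall>i. c i \<in> cidx (N i)},
       cdom = (\<lambda>c. I \<times> {p. \<forall>i. p i \<in> cdom (N i) (c i)}),
       cmap = (\<lambda>c (s, p). (s, \<chi> i. cmap (N i) (c i) (p i))),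
       cmetric = (\<lambda>c (s, x) (a, u) (b, v).
          a * b + (\<Sum>i\<in>UNIV. (h i s)\<^sup>2 * cmetric (N i) (c i) (x $ i) (u $ i) (v $ i))) \<rparr>"

text \<open>
  The last clause says that no two fibers could be combined into a single one.
\<close>

definition warped_product_data ::
  "real set \<Rightarrow> ('k::finite \<Rightarrow> real \<Rightarrow> real) \<Rightarrow> ('k \<Rightarrow> ('i, 'p, 'e::euclidean_space) riem_mfd) \<Rightarrow> bool" where
  "warped_product_data I h N \<longleftrightarrow>
     open I \<and> connected I \<and> I \<noteq> {} \<and>
     (\<forall>i. smooth_on I (h i) \<and> (\<forall>s\<in>I. h i s > 0)) \<and>
     (\<forall>i. connected_riemannian_manifold (N i)) \<and>
     (\<forall>i j. i \<noteq> j \<longrightarrow> \<not> (\<exists>c>0. \<forall>s\<in>I. h i s = c * h j s))"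

definition d_s :: "real \<times> ('e::euclidean_space ^ 'k)" where
  "d_s = (1, 0)"

definition fiber_vec :: "'k \<Rightarrow> 'e \<Rightarrow> real \<times> ('e::euclidean_space ^ 'k::finite)" where
  "fiber_vec i u = (0, axis i u)"

definition zero_radial_Weyl ::
  "('c, 'q, real \<times> ('e::euclidean_space ^ 'k::finite)) riem_mfd \<Rightarrow> bool" where
  "zero_radial_Weyl M \<longleftrightarrow>
     (\<forall>c\<in>cidx M. \<forall>x\<in>cimg M c. \<forall>v w z. Weyl (cmetric M c) x d_s v w z = 0)"

text \<open>
  The set of all values \<open>W(U\<^sub>i, U\<^sub>j, U\<^sub>i, U\<^sub>j)\<close> at the point with coordinates \<open>x\<close> in the chart \<open>c\<close>.
\<close>

definition mixed_Weyl_components ::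
  "('c, 'q, real \<times> ('e::euclidean_space ^ 'k::finite)) riem_mfd \<Rightarrow> 'c \<Rightarrow>
   real \<times> ('e ^ 'k) \<Rightarrow> real set" where
  "mixed_Weyl_components M c x =
     {Weyl (cmetric M c) x U V U V | U V.
        \<exists>i j u v. i \<noteq> j \<and> U = fiber_vec i u \<and> V = fiber_vec j v \<and>
          cmetric M c x U U = 1 \<and> cmetric M c x V V = 1}"

end

theory Submission
  imports Defs
begin

text \<open>
  The example is explicit. On \<open>I = {0<..}\<close> take the warping functions \<open>t (1 + t)\<close>, \<open>1 + t\<close> and \<open>t\<close>,
  and let all three fibers be round \<open>r\<close>-spheres, without a point, of curvature
  \<open>\<kappa> = (2 r - 1) / (r - 1)\<close>, hence Einstein with constant \<open>2 r - 1\<close>.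

  How these functions are found. As long as the radial Weyl curvature vanishes, a conformal change by
  a function of the parameter alone preserves both that condition and the vanishing of the divergence
  of the Weyl tensor. So the third warping function may be scaled to \<open>1\<close>. The Schouten tensor is then
  diagonal with a constant eigenvalue \<open>p\<close> on the third fiber, and the Codazzi equation turns into linear
  equations \<open>h\<^sub>i'' = 2 p h\<^sub>i - c\<^sub>i\<close> for \<open>i = 1, 2\<close>, together with the constancy of
  \<open>c\<^sub>1 / h\<^sub>1 + c\<^sub>2 / h\<^sub>2\<close>. The solution \<open>1 + exp \<sigma>\<close>, \<open>1 + exp (- \<sigma>)\<close>, \<open>1\<close> satisfies the remaining
  equations if all fibers have Einstein constant \<open>2 r - 1\<close>. Rescaling the metric by \<open>exp (2 \<sigma>)\<close> and
  writing \<open>t = exp \<sigma>\<close> gives the polynomials above, none of which has a critical point in \<open>I\<close>.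

  Why they work. With respect to the splitting of the tangent space into the radial line and the three
  fibers, all curvature tensors are determined by matrices indexed by these blocks. Sectional curvatures are
  \<open>- h\<^sub>i'' / h\<^sub>i\<close> in radial planes, \<open>- (h\<^sub>i' / h\<^sub>i) (h\<^sub>j' / h\<^sub>j)\<close> in mixed planes and
  \<open>\<kappa> / h\<^sub>i\<^sup>2 - (h\<^sub>i' / h\<^sub>i)\<^sup>2\<close> within a fiber (\<open>Rm_block\<close>); traces then give the Ricci and the Weyl
  coefficients (\<open>Weyl_block\<close>). For the functions above the radial Weyl coefficients vanish, and the
  mixed ones are
    \<open>w\<^sub>1\<^sub>2 = 1 / (t (1 + t)\<^sup>2)\<close>, \<open>w\<^sub>1\<^sub>3 = - 1 / (t\<^sup>2 (1 + t))\<close>, \<open>w\<^sub>2\<^sub>3 = - 1 / (t (1 + t))\<close>,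
  which have both signs (\<open>weyl_values\<close>). A tensor of this form without radial components is divergence
  free iff an algebraic relation between its coefficients and the logarithmic derivatives of the warping
  functions holds (\<open>div_fiber_tensor\<close>). For a trace-free one it reads
  \<open>\<Sum>\<^sub>i w\<^sub>i\<^sub>j (h\<^sub>i' / h\<^sub>i - h\<^sub>j' / h\<^sub>j) = 0\<close> for every \<open>j\<close>. Each of these three sums has two nonzero terms,
  namely \<open>1 / (t\<^sup>2 (1 + t)\<^sup>2)\<close> and its negative.
\<close>

section \<open>Closure properties of smooth functions\<close>

text \<open>
  Derivatives are only known through formulas valid on \<open>S\<close>, whereas \<open>Ck_on\<close> speaks about
  \<open>frechet_derivative\<close> as a total function; on an open set the two may be exchanged.
\<close>
lemma Ck_on_cong:
  assumes "open S" "\<And>x. x \<in> S \<Longrightarrow> f x = g x" "Ck_on k S f"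
  shows "Ck_on k S g"
  using assms(2,3)
proof (induction k arbitrary: f g)
  case 0
  then show ?case by (simp cong: continuous_on_cong)
next
  case (Suc k)
  have der: "(g has_derivative frechet_derivative f (at x)) (at x)" if "x \<in> S" for x
  proof (rule has_derivative_transform_within_open[OF _ assms(1) that])
    show "(f has_derivative frechet_derivative f (at x)) (at x)"
      using Suc.prems that by (simp add: frechet_derivative_works[symmetric])
  qed (use Suc.prems in auto)
  have "Ck_on k S (\<lambda>x. frechet_derivative g (at x) v)" for v
  proof (rule Suc.IH)
    show "frechet_derivative f (at x) v = frechet_derivative g (at x) v" if "x \<in> S" for x
      using frechet_derivative_at[OF der[OF that]] by simp
    show "Ck_on k S (\<lambda>x. frechet_derivative f (at x) v)"
      using Suc.prems by simp
  qed
  then show ?case using der by (auto simp: differentiable_def)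
qed

lemma Ck_on_SucI:
  assumes "open S"
    and "\<And>x. x \<in> S \<Longrightarrow> (f has_derivative f' x) (at x)"
    and "\<And>v. Ck_on k S (\<lambda>x. f' x v)"
  shows "Ck_on (Suc k) S f"
proof -
  have "Ck_on k S (\<lambda>x. frechet_derivative f (at x) v)" for v
    by (rule Ck_on_cong[OF assms(1) _ assms(3)[of v]])
       (simp add: frechet_derivative_at[OF assms(2), symmetric])
  then show ?thesis using assms(2) by (auto simp: differentiable_def)
qed

lemma Ck_on_Suc_has_derivative:
  assumes "Ck_on (Suc k) S f" "x \<in> S"
  shows "(f has_derivative frechet_derivative f (at x)) (at x)"
  using assms by (simp add: frechet_derivative_works[symmetric])

lemma Ck_on_SucD: "Ck_on (Suc k) S f \<Longrightarrow> Ck_on k S f"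
proof (induction k arbitrary: f)
  case 0
  then show ?case
    by (auto intro!: continuous_at_imp_continuous_on differentiable_imp_continuous_within)
next
  case (Suc k)
  then show ?case by (metis Ck_on.simps(2))
qed

lemma Ck_on_const: "Ck_on k S (\<lambda>_. a)"
  by (induction k arbitrary: a) auto

lemma Ck_on_bounded_linear:
  assumes "open S" "bounded_linear f"
  shows "Ck_on k S f"
proof (cases k)
  case 0
  then show ?thesis using assms by (simp add: linear_continuous_on)
next
  case (Suc m)
  have "Ck_on (Suc m) S f"
    by (rule Ck_on_SucI[where f' = "\<lambda>_. f", OF assms(1)])
       (auto intro: bounded_linear_imp_has_derivative assms Ck_on_const)
  then show ?thesis using Suc by simp
qed

lemma Ck_on_add:
  assumes "open S" "Ck_on k S f" "Ck_on k S g"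
  shows "Ck_on k S (\<lambda>x. f x + g x)"
  using assms(2,3)
proof (induction k arbitrary: f g)
  case 0
  then show ?case by (simp add: continuous_on_add)
next
  case (Suc k)
  show ?case
    by (rule Ck_on_SucI[OF assms(1) has_derivative_add[OF Ck_on_Suc_has_derivative[OF Suc.prems(1)]
          Ck_on_Suc_has_derivative[OF Suc.prems(2)]]])
       (use Suc in auto)
qed

lemma Ck_on_bilinear:
  assumes "bounded_bilinear B" "open S" "Ck_on k S f" "Ck_on k S g"
  shows "Ck_on k S (\<lambda>x. B (f x) (g x))"
  using assms(3,4)
proof (induction k arbitrary: f g)
  case 0
  then show ?case by (simp add: bounded_bilinear.continuous_on[OF assms(1)])
next
  case (Suc k)
  show ?case
  proof (rule Ck_on_SucI[OF assms(2) bounded_bilinear.FDERIV[OF assms(1)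
          Ck_on_Suc_has_derivative[OF Suc.prems(1)] Ck_on_Suc_has_derivative[OF Suc.prems(2)]]])
    show "Ck_on k S (\<lambda>x. B (f x) (frechet_derivative g (at x) v) + B (frechet_derivative f (at x) v) (g x))" for v
      using Suc.prems Suc.prems[THEN Ck_on_SucD]
      by (intro Ck_on_add[OF assms(2)] Suc.IH) auto
  qed
qed

lemmas Ck_on_mult = Ck_on_bilinear[OF bounded_bilinear_mult]

lemma Ck_on_inverse:
  fixes f :: "'a::real_normed_vector \<Rightarrow> real"
  assumes "open S" "Ck_on k S f" "\<And>x. x \<in> S \<Longrightarrow> f x \<noteq> 0"
  shows "Ck_on k S (\<lambda>x. inverse (f x))"
  using assms(2,3)
proof (induction k arbitrary: f)
  case 0
  then show ?case by (simp add: continuous_on_inverse)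
next
  case (Suc k)
  have inv: "Ck_on k S (\<lambda>x. inverse (f x))"
    using Suc Ck_on_SucD by blast
  show ?case
  proof (rule Ck_on_SucI[OF assms(1) Deriv.has_derivative_inverse[OF _ Ck_on_Suc_has_derivative[OF Suc.prems(1)]]])
    fix v
    have "Ck_on k S (\<lambda>x. (-1) * (inverse (f x) * frechet_derivative f (at x) v * inverse (f x)))"
      by (intro Ck_on_mult[OF assms(1)] Ck_on_const inv) (use Suc.prems in auto)
    then show "Ck_on k S (\<lambda>x. - (inverse (f x) * frechet_derivative f (at x) v * inverse (f x)))"
      by simp
  qed (use Suc.prems in auto)
qed

section \<open>Traces in orthogonal coordinates\<close>

lemma sharp_eqI:
  assumes "bilinear (G x)" "\<And>u. u \<noteq> 0 \<Longrightarrow> G x u u > 0" "\<And>w. G x v w = L w"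
  shows "sharp G x L = v"
  unfolding sharp_def
proof (rule the_equality)
  fix v' assume "\<forall>w. G x v' w = L w"
  then have "G x (v' - v) (v' - v) = 0"
    by (simp add: bilinear_lsub[OF assms(1)] assms(3))
  then show "v' = v"
    using assms(2)[of "v' - v"] by fastforce
qed (use assms(3) in simp)

text \<open>
  The matrix of the metric is diagonal in such coordinates, hence so is its inverse, and only the
  diagonal entries of \<open>B\<close> contribute.
\<close>
lemma metric_trace_orthogonal:
  assumes bil: "bilinear (G x)" and pos: "\<And>u. u \<noteq> 0 \<Longrightarrow> G x u u > 0"
    and orth: "\<And>a b. a \<in> Basis \<Longrightarrow> b \<in> Basis \<Longrightarrow> a \<noteq> b \<Longrightarrow> G x a b = 0"
  shows "metric_trace G x B = (\<Sum>a\<in>Basis. B a a / G x a a)"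
proof -
  have "cometric G x a b = (if a = b then 1 / G x a a else 0)" if "a \<in> Basis" "b \<in> Basis" for a b
  proof -
    have "G x ((1 / G x b b) *\<^sub>R b) w = w \<bullet> b" for w
    proof -
      have "G x b w = (\<Sum>a\<in>Basis. (w \<bullet> a) * G x b a)"
        by (subst euclidean_representation[of w, symmetric])
           (simp add: linear_sum[OF bilinear_def[THEN iffD1, OF bil, THEN conjunct1, rule_format]]
              bilinear_rmul[OF bil])
      also have "\<dots> = (\<Sum>a\<in>Basis. if a = b then (w \<bullet> b) * G x b b else 0)"
        by (rule sum.cong) (use orth that in auto)
      finally show ?thesis
        using pos[of b] that by (simp add: bilinear_lmul[OF bil] nonzero_Basis)
    qed
    then have "sharp G x (\<lambda>w. w \<bullet> b) = (1 / G x b b) *\<^sub>R b"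
      by (intro sharp_eqI[of G x, OF bil pos])
    then show ?thesis
      using that by (simp add: cometric_def inner_Basis)
  qed
  then show ?thesis
    by (simp add: metric_trace_def if_distrib[of "\<lambda>c. c * _"] cong: if_cong sum.cong)
qed

lemma metric_trace_add: "metric_trace G x (\<lambda>a b. A a b + B a b) = metric_trace G x A + metric_trace G x B"
  and metric_trace_diff: "metric_trace G x (\<lambda>a b. A a b - B a b) = metric_trace G x A - metric_trace G x B"
  and metric_trace_cmult: "metric_trace G x (\<lambda>a b. c * A a b) = c * metric_trace G x A"
  by (simp_all add: metric_trace_def algebra_simps sum.distrib sum_subtractf sum_distrib_left)

lemma metric_trace_sum:
  "metric_trace G x (\<lambda>a b. \<Sum>i\<in>T. F i a b) = (\<Sum>i\<in>T. metric_trace G x (F i))"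
  by (induction T rule: infinite_finite_induct)
    (simp_all add: metric_trace_add, simp_all add: metric_trace_def)

section \<open>Recognising the Levi-Civita connection\<close>

text \<open>
  The Levi-Civita connection is the only torsion-free connection that preserves the metric, so a
  candidate for the Christoffel symbols can be checked without inverting the metric. Derivatives at
  a point see a neighbourhood only, whence the open set \<open>S\<close>.
\<close>

locale levi_civita =
  fixes S :: "'e::euclidean_space set" and G :: "'e metric_field" and \<Gamma> :: "'e \<Rightarrow> 'e \<Rightarrow> 'e \<Rightarrow> 'e"
  assumes open_S: "open S"
    and bil: "x \<in> S \<Longrightarrow> bilinear (G x)"
    and sym: "x \<in> S \<Longrightarrow> G x u v = G x v u"
    and pos: "x \<in> S \<Longrightarrow> u \<noteq> 0 \<Longrightarrow> G x u u > 0"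
    and conn_bil: "x \<in> S \<Longrightarrow> bilinear (\<Gamma> x)"
    and conn_sym: "x \<in> S \<Longrightarrow> \<Gamma> x u v = \<Gamma> x v u"
    and compat: "x \<in> S \<Longrightarrow>
      ((\<lambda>y. G y u v) has_derivative (\<lambda>e. G x (\<Gamma> x e u) v + G x u (\<Gamma> x e v))) (at x)"
begin

lemma christoffel_eq:
  assumes x: "x \<in> S"
  shows "christoffel G x u v = \<Gamma> x u v"
proof -
  have fd: "frechet_derivative (\<lambda>y. G y u v) (at x) = (\<lambda>e. G x (\<Gamma> x e u) v + G x u (\<Gamma> x e v))" for u v
    using frechet_derivative_at[OF compat[OF x]] by simp
  show ?thesis
    unfolding christoffel_def fd
  proof (rule sharp_eqI[of G x, OF bil[OF x] pos[OF x]])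
    fix z
    have "G x v (\<Gamma> x u z) = G x (\<Gamma> x z u) v" "G x u (\<Gamma> x v z) = G x u (\<Gamma> x z v)" 
         "G x (\<Gamma> x v u) z = G x (\<Gamma> x u v) z"
      by (simp_all add: sym[OF x] conn_sym[OF x])
    then show "G x (\<Gamma> x u v) z = (G x (\<Gamma> x u v) z + G x v (\<Gamma> x u z) + (G x (\<Gamma> x v u) z + G x u (\<Gamma> x v z))
       - (G x (\<Gamma> x z u) v + G x u (\<Gamma> x z v))) / 2"
      by simp
  qed
qed

lemma nabla_const: "x \<in> S \<Longrightarrow> nabla G (\<lambda>_. u) (\<lambda>_. v) x = \<Gamma> x u v"
  by (simp add: nabla_def christoffel_eq)

lemma nabla_nabla_const:
  assumes x: "x \<in> S" and D: "((\<lambda>y. \<Gamma> y u w) has_derivative A) (at x)"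
  shows "nabla G (\<lambda>_. v) (nabla G (\<lambda>_. u) (\<lambda>_. w)) x = A v + \<Gamma> x v (\<Gamma> x u w)"
proof -
  have "(nabla G (\<lambda>_. u) (\<lambda>_. w) has_derivative A) (at x)"
    by (rule has_derivative_transform_within_open[OF D open_S x]) (simp add: nabla_const)
  then have "frechet_derivative (nabla G (\<lambda>_. u) (\<lambda>_. w)) (at x) = A"
    using frechet_derivative_at by metis
  then show ?thesis
    using x by (simp add: nabla_def[of G "\<lambda>_. v"] christoffel_eq nabla_const)
qed

text \<open>
  The Lie bracket of constant fields vanishes, so only the commutator of second derivatives is left.
  The hypotheses ask for derivatives of \<open>\<Gamma>\<close>, which is given by an explicit formula in all
  applications, and not of \<open>christoffel\<close>.
\<close>
lemma Rm_eq:
  assumes x: "x \<in> S" and A: "((\<lambda>y. \<Gamma> y u w) has_derivative A) (at x)"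
    and B: "((\<lambda>y. \<Gamma> y v w) has_derivative B) (at x)"
  shows "Rm G x u v w z = G x (A v + \<Gamma> x v (\<Gamma> x u w) - (B u + \<Gamma> x u (\<Gamma> x v w))) z"
proof -
  have "nabla G (lie_bracket (\<lambda>_. u) (\<lambda>_. v)) (\<lambda>_. w) x = 0"
    using x by (simp add: nabla_def lie_bracket_def christoffel_eq bilinear_lzero[OF conn_bil])
  then show ?thesis
    by (simp add: Rm_def Rm_field_def nabla_nabla_const[OF x A] nabla_nabla_const[OF x B])
qed

end

section \<open>Curvature tensors assembled from orthogonal blocks\<close>

text \<open>
  If the metric is an orthogonal sum of blocks \<open>q \<alpha>\<close> and \<open>K\<close> is symmetric, this is half the sum of
  the Kulkarni-Nomizu products of \<open>q \<alpha>\<close> and \<open>q \<beta>\<close> weighted by \<open>K \<alpha> \<beta>\<close>. If the tensor is the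
  Riemann tensor, \<open>K \<alpha> \<beta>\<close> is the sectional curvature of a plane spanned by a direction of block
  \<open>\<alpha>\<close> and one of block \<open>\<beta>\<close>. All curvature tensors below have this form, which reduces the
  tensor calculus to computations with the small matrix \<open>K\<close>.
\<close>

definition block_tensor ::
  "('b::finite \<Rightarrow> 'e \<Rightarrow> 'e \<Rightarrow> real) \<Rightarrow> ('b \<Rightarrow> 'b \<Rightarrow> real) \<Rightarrow> 'e \<Rightarrow> 'e \<Rightarrow> 'e \<Rightarrow> 'e \<Rightarrow> real" where
  "block_tensor q K u v w z =
     (\<Sum>\<alpha>\<in>UNIV. \<Sum>\<beta>\<in>UNIV. K \<alpha> \<beta> * (q \<alpha> u w * q \<beta> v z - q \<alpha> u z * q \<beta> v w))"

text \<open>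
  The parameter \<open>n\<close> gives the dimensions of the blocks. The subtracted term is there because a
  direction of block \<open>\<beta>\<close> spans planes with only \<open>n \<beta> - 1\<close> further directions of its own block.
\<close>
definition ricci_coeff :: "('b::finite \<Rightarrow> real) \<Rightarrow> ('b \<Rightarrow> 'b \<Rightarrow> real) \<Rightarrow> 'b \<Rightarrow> real" where
  "ricci_coeff n K \<beta> = (\<Sum>\<alpha>\<in>UNIV. n \<alpha> * K \<alpha> \<beta>) - K \<beta> \<beta>"

definition scalar_coeff :: "('b::finite \<Rightarrow> real) \<Rightarrow> ('b \<Rightarrow> 'b \<Rightarrow> real) \<Rightarrow> real" where
  "scalar_coeff n K = (\<Sum>\<beta>\<in>UNIV. n \<beta> * ricci_coeff n K \<beta>)"

definition weyl_coeff :: "real \<Rightarrow> ('b::finite \<Rightarrow> real) \<Rightarrow> ('b \<Rightarrow> 'b \<Rightarrow> real) \<Rightarrow> 'b \<Rightarrow> 'b \<Rightarrow> real" where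
  "weyl_coeff d n K \<alpha> \<beta> =
     K \<alpha> \<beta> - (ricci_coeff n K \<alpha> + ricci_coeff n K \<beta>) / (d - 2)
     + scalar_coeff n K / ((d - 1) * (d - 2))"

text \<open>
  Orthogonality of the blocks enters as a rule for traces: contracting two blocks against each other
  gives zero if they differ, and the block itself if they agree.
\<close>
locale orthogonal_blocks =
  fixes G :: "'e::euclidean_space metric_field" and x :: 'e
    and q :: "'b::finite \<Rightarrow> 'e \<Rightarrow> 'e \<Rightarrow> real" and n :: "'b \<Rightarrow> real"
  assumes block_sym: "q \<alpha> u v = q \<alpha> v u"
    and metric_eq_sum: "G x u v = (\<Sum>\<alpha>\<in>UNIV. q \<alpha> u v)"
    and trace_block: "metric_trace G x (\<lambda>a b. q \<alpha> a b) = n \<alpha>"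
    and trace_block_mult:
      "metric_trace G x (\<lambda>a b. q \<alpha> a u * q \<beta> b v) = (if \<alpha> = \<beta> then q \<alpha> u v else 0)"
begin

context
  fixes K :: "'b \<Rightarrow> 'b \<Rightarrow> real"
  assumes Rm_block: "\<And>u v w z. Rm G x u v w z = block_tensor q K u v w z"
begin

lemma Ric_block: "Ric G x v z = (\<Sum>\<beta>\<in>UNIV. ricci_coeff n K \<beta> * q \<beta> v z)"
proof -
  have "metric_trace G x (\<lambda>a b. q \<alpha> a z * q \<beta> v b) = (if \<alpha> = \<beta> then q \<alpha> v z else 0)" for \<alpha> \<beta>
  proof -
    have "(\<lambda>a b. q \<alpha> a z * q \<beta> v b) = (\<lambda>a b. q \<alpha> a z * q \<beta> b v)"
      by (intro ext) (metis block_sym)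
    then show ?thesis using trace_block_mult[of \<alpha> z \<beta> v] block_sym[of \<beta> z v] by auto
  qed
  moreover have "metric_trace G x (\<lambda>a b. q \<alpha> a b * q \<beta> v z) = n \<alpha> * q \<beta> v z" for \<alpha> \<beta>
    using metric_trace_cmult[of G x "q \<beta> v z" "q \<alpha>"] by (simp add: trace_block mult.commute)
  ultimately have "Ric G x v z =
      (\<Sum>\<alpha>\<in>UNIV. \<Sum>\<beta>\<in>UNIV. K \<alpha> \<beta> * (n \<alpha> * q \<beta> v z - (if \<alpha> = \<beta> then q \<alpha> v z else 0)))"
    unfolding Ric_def Rm_block block_tensor_def
    by (simp add: metric_trace_sum metric_trace_cmult metric_trace_diff)
  also have "\<dots> = (\<Sum>\<beta>\<in>UNIV. \<Sum>\<alpha>\<in>UNIV. K \<alpha> \<beta> * (n \<alpha> * q \<beta> v z - (if \<alpha> = \<beta> then q \<alpha> v z else 0)))"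
    by (rule sum.swap)
  also have "\<dots> = (\<Sum>\<beta>\<in>UNIV. ricci_coeff n K \<beta> * q \<beta> v z)"
    by (simp add: ricci_coeff_def right_diff_distrib left_diff_distrib sum_subtractf sum_distrib_left
        if_distrib[of "\<lambda>c. _ * c"] mult_ac cong: if_cong)
  finally show ?thesis .
qed

lemma Scal_block: "Scal G x = scalar_coeff n K"
proof -
  have "Ric G x = (\<lambda>v z. \<Sum>\<beta>\<in>UNIV. ricci_coeff n K \<beta> * q \<beta> v z)"
    by (intro ext Ric_block)
  then show ?thesis
    by (simp add: Scal_def scalar_coeff_def metric_trace_sum metric_trace_cmult trace_block mult.commute)
qed

text \<open>
  Ricci and metric are diagonal with respect to the blocks, so their Kulkarni-Nomizu product is again
  a block tensor, with entries \<open>\<rho> \<alpha> + \<rho> \<beta>\<close> for the Ricci eigenvalues \<open>\<rho>\<close>.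
\<close>
lemma Weyl_block: "Weyl G x u v w z = block_tensor q (weyl_coeff (real DIM('e)) n K) u v w z"
proof -
  let ?\<rho> = "ricci_coeff n K"
  let ?d = "real DIM('e)"
  have prod: "(\<Sum>\<alpha>\<in>UNIV. a \<alpha> * A \<alpha>) * (\<Sum>\<beta>\<in>UNIV. B \<beta>) = (\<Sum>\<alpha>\<in>UNIV. \<Sum>\<beta>\<in>UNIV. a \<alpha> * (A \<alpha> * B \<beta>))"
    "(\<Sum>\<beta>\<in>UNIV. a \<beta> * B \<beta>) * (\<Sum>\<alpha>\<in>UNIV. A \<alpha>) = (\<Sum>\<alpha>\<in>UNIV. \<Sum>\<beta>\<in>UNIV. a \<beta> * (A \<alpha> * B \<beta>))"
    for a A B :: "'b \<Rightarrow> real"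
  proof -
    show "(\<Sum>\<alpha>\<in>UNIV. a \<alpha> * A \<alpha>) * (\<Sum>\<beta>\<in>UNIV. B \<beta>) = (\<Sum>\<alpha>\<in>UNIV. \<Sum>\<beta>\<in>UNIV. a \<alpha> * (A \<alpha> * B \<beta>))"
      by (simp add: sum_product mult.assoc)
    show "(\<Sum>\<beta>\<in>UNIV. a \<beta> * B \<beta>) * (\<Sum>\<alpha>\<in>UNIV. A \<alpha>) = (\<Sum>\<alpha>\<in>UNIV. \<Sum>\<beta>\<in>UNIV. a \<beta> * (A \<alpha> * B \<beta>))"
      by (subst mult.commute) (simp add: sum_product mult_ac)
  qed
  have ricci_part: "Ric G x u w * G x v z + Ric G x v z * G x u w - Ric G x u z * G x v w - Ric G x v w * G x u z
      = block_tensor q (\<lambda>\<alpha> \<beta>. ?\<rho> \<alpha> + ?\<rho> \<beta>) u v w z"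
    unfolding Ric_block metric_eq_sum prod(1)[of ?\<rho> "\<lambda>\<beta>. q \<beta> u w"] prod(1)[of ?\<rho> "\<lambda>\<beta>. q \<beta> u z"]
      prod(2)[of ?\<rho> "\<lambda>\<beta>. q \<beta> v w"] prod(2)[of ?\<rho> "\<lambda>\<beta>. q \<beta> v z"] block_tensor_def
    by (simp add: algebra_simps sum.distrib sum_subtractf)
  have scalar_part: "G x u w * G x v z - G x u z * G x v w = block_tensor q (\<lambda>\<alpha> \<beta>. 1) u v w z"
    by (simp add: metric_eq_sum block_tensor_def sum_product sum_subtractf)
  show ?thesis
    unfolding Weyl_def Let_def ricci_part Scal_block scalar_part Rm_block
    by (simp add: block_tensor_def weyl_coeff_def algebra_simps diff_divide_distrib add_divide_distrib
        sum.distrib sum_subtractf sum_divide_distrib sum_distrib_left)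
qed

end

end

section \<open>Round spheres in a stereographic chart\<close>

text \<open>
  A metric of constant curvature on a whole coordinate space, with its connection \<open>\<gamma>\<close> and the
  directional derivative \<open>D\<gamma> x e\<close> of \<open>\<gamma>\<close> in direction \<open>e\<close>. The conformally flat form makes the
  coordinate basis orthogonal, which is all that the trace formulas need.
\<close>

locale conformal_space_form = levi_civita UNIV g \<gamma>
  for g :: "'e::euclidean_space metric_field" and \<gamma> :: "'e \<Rightarrow> 'e \<Rightarrow> 'e \<Rightarrow> 'e" +
  fixes D\<gamma> :: "'e \<Rightarrow> 'e \<Rightarrow> 'e \<Rightarrow> 'e \<Rightarrow> 'e" and \<phi> :: "'e \<Rightarrow> real" and \<kappa> :: real
  assumes conn_deriv: "((\<lambda>y. \<gamma> y u w) has_derivative (\<lambda>e. D\<gamma> x e u w)) (at x)"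
    and constant_curvature:
      "D\<gamma> x v u w + \<gamma> x v (\<gamma> x u w) - (D\<gamma> x u v w + \<gamma> x u (\<gamma> x v w)) =
         \<kappa> *\<^sub>R (g x u w *\<^sub>R v - g x v w *\<^sub>R u)"
    and conformal: "g x u v = \<phi> x * (u \<bullet> v)"
begin

lemma conformal_factor_pos: "\<phi> x > 0"
proof -
  obtain b :: 'e where "b \<in> Basis" using nonempty_Basis by blast
  then show ?thesis using pos[of x b] by (simp add: conformal nonzero_Basis)
qed

lemma metric_trace_conformal: "metric_trace g x B = (\<Sum>a\<in>Basis. B a a) / \<phi> x"
  by (subst metric_trace_orthogonal[of g x, OF bil pos]) 
     (auto simp: conformal inner_Basis sum_divide_distrib)

lemma Rm_space_form: "Rm g x u v w z = \<kappa> * (g x u w * g x v z - g x v w * g x u z)"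
  unfolding Rm_eq[OF UNIV_I conn_deriv conn_deriv] constant_curvature
  by (simp add: conformal algebra_simps inner_diff_left)

lemma Ric_space_form: "Ric g x v z = (real DIM('e) - 1) * \<kappa> * g x v z"
proof -
  have "Ric g x v z = (\<Sum>a\<in>Basis. \<kappa> * \<phi> x * ((v \<bullet> z) - (v \<bullet> a) * (z \<bullet> a)))"
    using conformal_factor_pos[of x] unfolding Ric_def metric_trace_conformal sum_divide_distrib
    by (intro sum.cong) (simp_all add: Rm_space_form conformal inner_Basis field_simps inner_commute)
  also have "\<dots> = \<kappa> * \<phi> x * (real DIM('e) * (v \<bullet> z) - v \<bullet> z)"
    by (simp add: sum_distrib_left[symmetric] sum_subtractf euclidean_inner[of v z])
  finally show ?thesis by (simp add: conformal algebra_simps)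
qed

end

text \<open>
  The conformal factor of the unit sphere in stereographic coordinates.
\<close>
definition sph_factor :: "'e::euclidean_space \<Rightarrow> real" where
  "sph_factor x = 2 / (1 + x \<bullet> x)"

definition sph_metric :: "real \<Rightarrow> 'e::euclidean_space metric_field" where
  "sph_metric R x u v = R * (sph_factor x)\<^sup>2 * (u \<bullet> v)"

definition sph_conn :: "'e::euclidean_space \<Rightarrow> 'e \<Rightarrow> 'e \<Rightarrow> 'e" where
  "sph_conn x u v = sph_factor x *\<^sub>R ((u \<bullet> v) *\<^sub>R x - (x \<bullet> u) *\<^sub>R v - (x \<bullet> v) *\<^sub>R u)"

definition sph_conn_deriv :: "'e::euclidean_space \<Rightarrow> 'e \<Rightarrow> 'e \<Rightarrow> 'e \<Rightarrow> 'e" where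
  "sph_conn_deriv x e u v =
     sph_factor x *\<^sub>R ((u \<bullet> v) *\<^sub>R e - (e \<bullet> u) *\<^sub>R v - (e \<bullet> v) *\<^sub>R u)
     - ((sph_factor x)\<^sup>2 * (x \<bullet> e)) *\<^sub>R ((u \<bullet> v) *\<^sub>R x - (x \<bullet> u) *\<^sub>R v - (x \<bullet> v) *\<^sub>R u)"

lemma one_plus_inner_pos: "1 + x \<bullet> (x::'e::euclidean_space) > 0"
  by (simp add: add_pos_nonneg)

lemma sph_factor_pos: "sph_factor x > 0"
  using one_plus_inner_pos[of x] by (simp add: sph_factor_def)

lemma sph_factor_inner: "sph_factor x * (x \<bullet> x) = 2 - sph_factor x"
  using one_plus_inner_pos[of x] by (simp add: sph_factor_def field_simps)

lemma sph_factor_has_derivative: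
  "(sph_factor has_derivative (\<lambda>e. - ((sph_factor x)\<^sup>2 * (x \<bullet> e)))) (at x)"
proof -
  have nz: "1 + x \<bullet> x \<noteq> 0" using one_plus_inner_pos[of x] by simp
  have "((\<lambda>x. 2 / (1 + x \<bullet> x)) has_derivative (\<lambda>e. - ((2 / (1 + x \<bullet> x))\<^sup>2 * (x \<bullet> e)))) (at x)"
    by (rule derivative_eq_intros refl nz)+
       (use nz in \<open>simp add: fun_eq_iff inner_commute field_simps power2_eq_square\<close>)
  then show ?thesis by (simp add: sph_factor_def[abs_def])
qed

text \<open>
  Paired with a vector, both sides become polynomials in inner products. They agree modulo the
  relation \<open>sph_factor_inner\<close>, which ties the norm of \<open>x\<close> to the conformal factor.
\<close>
lemma sph_conn_curvature:
  "sph_conn_deriv x v u w + sph_conn x v (sph_conn x u w) - (sph_conn_deriv x u v w + sph_conn x u (sph_conn x v w)) =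
     (sph_factor x)\<^sup>2 *\<^sub>R ((u \<bullet> w) *\<^sub>R v - (v \<bullet> w) *\<^sub>R u)" (is "?l = ?r")
proof -
  have "z \<bullet> ?l = z \<bullet> ?r" for z
  proof -
    define m X where "m = sph_factor x" and "X = x \<bullet> x"
    have "z \<bullet> ?l - z \<bullet> ?r = m * (2 - m - m * X) * ((u \<bullet> w) * (v \<bullet> z) - (v \<bullet> w) * (u \<bullet> z))"
      unfolding sph_conn_def sph_conn_deriv_def m_def[symmetric]
      by (simp add: inner_add_right inner_diff_right inner_add_left inner_diff_left X_def[symmetric])
         (simp add: inner_commute power2_eq_square algebra_simps)
    moreover have "2 - m - m * X = 0"
      by (simp add: m_def X_def sph_factor_inner)
    ultimately show ?thesis by simp
  qed
  then show ?thesis using vector_eq_ldot by blast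
qed

lemma sphere_space_form:
  assumes R: "R > 0"
  shows "conformal_space_form (sph_metric R :: 'e::euclidean_space metric_field)
     sph_conn sph_conn_deriv (\<lambda>x. R * (sph_factor x)\<^sup>2) (1 / R)"
proof
  fix x u v w e :: 'e
  show "bilinear (sph_metric R x)"
    by (auto simp: bilinear_def sph_metric_def inner_add_left inner_add_right algebra_simps intro!: linearI)
  show "sph_metric R x u v = sph_metric R x v u"
    by (simp add: sph_metric_def inner_commute)
  show "sph_metric R x u u > 0" if "u \<noteq> 0"
    using that R sph_factor_pos[of x] by (simp add: sph_metric_def)
  show "bilinear (sph_conn x)"
    by (auto simp: bilinear_def sph_conn_def inner_add_left inner_add_right algebra_simps intro!: linearI)
  show "sph_conn x u v = sph_conn x v u"
    by (simp add: sph_conn_def inner_commute algebra_simps)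
  show "((\<lambda>y. sph_metric R y u v) has_derivative
      (\<lambda>e. sph_metric R x (sph_conn x e u) v + sph_metric R x u (sph_conn x e v))) (at x)"
    unfolding sph_metric_def sph_conn_def
    by (rule derivative_eq_intros refl sph_factor_has_derivative)+
       (simp add: fun_eq_iff inner_diff_left inner_diff_right inner_commute algebra_simps power2_eq_square)
  show "((\<lambda>y. sph_conn y u w) has_derivative (\<lambda>e. sph_conn_deriv x e u w)) (at x)"
    unfolding sph_conn_def sph_conn_deriv_def
    by (rule derivative_eq_intros refl sph_factor_has_derivative)+
       (simp add: fun_eq_iff algebra_simps)
  show "sph_conn_deriv x v u w + sph_conn x v (sph_conn x u w) - (sph_conn_deriv x u v w + sph_conn x u (sph_conn x v w)) =
         (1 / R) *\<^sub>R (sph_metric R x u w *\<^sub>R v - sph_metric R x v w *\<^sub>R u)"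
    using R by (simp add: sph_conn_curvature sph_metric_def algebra_simps)
  show "sph_metric R x u v = R * (sph_factor x)\<^sup>2 * (u \<bullet> v)"
    by (simp add: sph_metric_def)
qed simp

text \<open>
  One stereographic chart covers the sphere without a point, so the coordinate space itself can serve
  as the set of points.
\<close>
definition sph_manifold :: "real \<Rightarrow> (nat, 'e::euclidean_space, 'e) riem_mfd" where
  "sph_manifold R =
     \<lparr> mtop = euclidean, cidx = {0}, cdom = (\<lambda>_. UNIV), cmap = (\<lambda>_. id), cmetric = (\<lambda>_. sph_metric R) \<rparr>"

lemma second_countable_euclidean: "second_countable (euclidean :: 'a::second_countable_topology topology)"
proof -
  obtain B :: "'a set set" where "countable B" "topological_basis B"
    using ex_countable_basis by blast
  then show ?thesis
    unfolding second_countable_def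
    by (intro exI[of _ B]) (metis open_openin topological_basis_def topological_basisE)
qed

lemma sph_metric_smooth: "smooth_on UNIV (\<lambda>x :: 'e::euclidean_space. sph_metric R x u v)"
  unfolding smooth_on_def
proof
  fix k
  have id: "Ck_on k UNIV (\<lambda>x :: 'e. x)"
    by (rule Ck_on_bounded_linear) simp_all
  have nz: "1 + x \<bullet> x \<noteq> 0" for x :: 'e
    using one_plus_inner_pos[of x] by simp
  have factor: "Ck_on k UNIV (\<lambda>x :: 'e. inverse (1 + x \<bullet> x))"
    by (intro Ck_on_inverse Ck_on_add Ck_on_const Ck_on_bilinear[OF bounded_bilinear_inner] id nz open_UNIV)
  have "Ck_on k UNIV (\<lambda>x :: 'e. R * (4 * (u \<bullet> v)) * (inverse (1 + x \<bullet> x) * inverse (1 + x \<bullet> x)))"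
    by (intro Ck_on_mult Ck_on_const factor open_UNIV)
  then show "Ck_on k UNIV (\<lambda>x :: 'e. sph_metric R x u v)"
    by (simp add: sph_metric_def sph_factor_def power2_eq_square divide_inverse mult_ac)
qed

lemma connected_sph_manifold:
  assumes "R > 0"
  shows "connected_riemannian_manifold (sph_manifold R :: (nat, 'e::euclidean_space, 'e) riem_mfd)"
proof -
  interpret conformal_space_form "sph_metric R :: 'e metric_field" sph_conn sph_conn_deriv
    "\<lambda>x. R * (sph_factor x)\<^sup>2" "1 / R"
    by (rule sphere_space_form[OF assms])
  have tr: "transition (sph_manifold R :: (nat, 'e, 'e) riem_mfd) k l = id" for k l
    by (simp add: transition_def sph_manifold_def)
  have "smooth_on UNIV (id :: 'e \<Rightarrow> 'e)"
    unfolding smooth_on_def id_def by (intro allI Ck_on_bounded_linear) simp_all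
  moreover have "local_metric UNIV (sph_metric R :: 'e metric_field)"
    using bil sym pos by (simp add: local_metric_def sph_metric_smooth)
  moreover have "connected_space (euclidean :: 'e topology)"
    using connectedin_topspace[of "euclidean :: 'e topology"] convex_connected[of "UNIV :: 'e set"] by simp
  ultimately show ?thesis
    unfolding connected_riemannian_manifold_def riemannian_manifold_def smooth_manifold_def tr
    by (simp add: sph_manifold_def cimg_def second_countable_euclidean homeomorphic_map_id frechet_derivative_id)
qed

section \<open>Multiply warped products of space forms\<close>

lemma sum_UNIV_option: "(\<Sum>\<alpha>\<in>UNIV. f \<alpha>) = f None + (\<Sum>i\<in>UNIV. f (Some i))"
  for f :: "'k::finite option \<Rightarrow> 'a::comm_monoid_add"
  by (simp add: UNIV_option_conv sum.reindex)

lemma sum_Basis_vec: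
  "(\<Sum>b\<in>Basis. f b) = (\<Sum>i\<in>UNIV. \<Sum>b\<in>Basis. f (axis i b))" for f :: "'e::euclidean_space ^ 'k::finite \<Rightarrow> real"
proof -
  have "(\<Sum>b\<in>Basis. f b) = (\<Sum>i\<in>UNIV. \<Sum>b\<in>axis i ` Basis. f b)"
    unfolding Basis_vec_def
    by (subst sum.UNION_disjoint[symmetric])
       (auto simp: axis_eq_axis nonzero_Basis intro!: sum.cong)
  also have "\<dots> = (\<Sum>i\<in>UNIV. \<Sum>b\<in>Basis. f (axis i b))"
    by (intro sum.cong refl) (simp add: sum.reindex inj_on_def axis_eq_axis)
  finally show ?thesis .
qed

lemma sum_Basis_prod:
  "(\<Sum>b\<in>Basis. f b) = (\<Sum>a\<in>Basis. f (a, 0)) + (\<Sum>b\<in>Basis. f (0, b))"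
  for f :: "'a::euclidean_space \<times> 'b::euclidean_space \<Rightarrow> 'c::comm_monoid_add"
proof -
  have "inj_on (\<lambda>u. (u::'a, 0::'b)) Basis" "inj_on (\<lambda>u. (0::'a, u::'b)) Basis"
    by (auto simp: inj_on_def)
  then show ?thesis
    unfolding Basis_prod_def
    by (subst sum.union_disjoint) (auto simp: sum.reindex Basis_prod_def nonzero_Basis)
qed

lemma has_derivative_vec_lambda:
  fixes f :: "'a::real_normed_vector \<Rightarrow> 'k::finite \<Rightarrow> 'e::euclidean_space"
  assumes "\<And>i. ((\<lambda>x. f x i) has_derivative f' i) F"
  shows "((\<lambda>x. \<chi> i. f x i) has_derivative (\<lambda>e. \<chi> i. f' i e)) F"
proof -
  have eq: "(\<chi> i. c i) = (\<Sum>i\<in>UNIV. axis i (c i))" for c :: "'k \<Rightarrow> 'e"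
    by (simp add: vec_eq_iff axis_def)
  have "bounded_linear (axis i :: 'e \<Rightarrow> 'e ^ 'k)" for i
    unfolding linear_conv_bounded_linear[symmetric]
    by (intro linearI) (auto simp: axis_def vec_eq_iff)
  then show ?thesis
    unfolding eq by (intro has_derivative_sum) (rule bounded_linear.has_derivative[OF _ assms])
qed

lemma has_derivative_fst_compose:
  assumes "(f has_real_derivative d) (at (fst p))"
  shows "((\<lambda>p. f (fst p)) has_derivative (\<lambda>e. d * fst e)) (at p)"
  using has_derivative_compose[OF has_derivative_fst[OF has_derivative_ident]
      assms[unfolded has_field_derivative_def], of UNIV] by simp

lemma has_derivative_fiber_compose:
  fixes f :: "'e::euclidean_space \<Rightarrow> 'b::real_normed_vector" and p :: "real \<times> ('e ^ 'k::finite)"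
  assumes "(f has_derivative f') (at (snd p $ i))"
  shows "((\<lambda>p. f (snd p $ i)) has_derivative (\<lambda>e. f' (snd e $ i))) (at p)"
  using has_derivative_compose[OF bounded_linear.has_derivative[OF bounded_linear_vec_nth
      has_derivative_snd[OF has_derivative_ident]] assms, of UNIV] by simp

text \<open>
  All fibers carry the same metric \<open>g\<close>; a constant factor on a fiber metric can be absorbed into the
  warping function of that fiber.
\<close>
locale warped_space_forms = conformal_space_form g \<gamma> D\<gamma> \<phi> \<kappa>
  for g :: "'e::euclidean_space metric_field" and \<gamma> D\<gamma> \<phi> \<kappa> +
  fixes I :: "real set" and h h' h'' :: "'k::finite \<Rightarrow> real \<Rightarrow> real"
  assumes open_I: "open I"
    and h_pos: "s \<in> I \<Longrightarrow> h i s > 0"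
    and h_deriv: "s \<in> I \<Longrightarrow> (h i has_real_derivative h' i s) (at s)"
    and h'_deriv: "s \<in> I \<Longrightarrow> (h' i has_real_derivative h'' i s) (at s)"
begin

definition log_deriv :: "'k \<Rightarrow> real \<Rightarrow> real" where
  "log_deriv i s = h' i s / h i s"

definition fiber_block :: "real \<times> ('e ^ 'k) \<Rightarrow> 'k \<Rightarrow> real \<times> ('e ^ 'k) \<Rightarrow> real \<times> ('e ^ 'k) \<Rightarrow> real" where
  "fiber_block p i u v = (h i (fst p))\<^sup>2 * g (snd p $ i) (snd u $ i) (snd v $ i)"

definition block :: "real \<times> ('e ^ 'k) \<Rightarrow> 'k option \<Rightarrow> real \<times> ('e ^ 'k) \<Rightarrow> real \<times> ('e ^ 'k) \<Rightarrow> real" where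
  "block p \<alpha> u v = (case \<alpha> of None \<Rightarrow> fst u * fst v | Some i \<Rightarrow> fiber_block p i u v)"

definition warped_metric :: "(real \<times> ('e ^ 'k)) metric_field" where
  "warped_metric p u v = fst u * fst v + (\<Sum>i\<in>UNIV. fiber_block p i u v)"

text \<open>
  The classical formulas for the connection of a warped product: \<open>\<nabla>\<close> of a field of the fiber \<open>i\<close> in
  the radial direction is multiplication by the logarithmic derivative of \<open>h i\<close>, the fibers have
  the second fundamental form \<open>- log_deriv i * fiber_block i\<close>, and different fibers do not interact
  otherwise.
\<close>
definition warped_conn :: "real \<times> ('e ^ 'k) \<Rightarrow> real \<times> ('e ^ 'k) \<Rightarrow> real \<times> ('e ^ 'k) \<Rightarrow> real \<times> ('e ^ 'k)" where
  "warped_conn p u v =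
     (- (\<Sum>i\<in>UNIV. log_deriv i (fst p) * fiber_block p i u v),
      \<chi> i. log_deriv i (fst p) *\<^sub>R (fst u *\<^sub>R snd v $ i + fst v *\<^sub>R snd u $ i)
           + \<gamma> (snd p $ i) (snd u $ i) (snd v $ i))"

abbreviation region :: "(real \<times> ('e ^ 'k)) set" where "region \<equiv> I \<times> UNIV"

lemmas g_simps = bilinear_ladd[OF bil[OF UNIV_I]] bilinear_radd[OF bil[OF UNIV_I]]
  bilinear_lsub[OF bil[OF UNIV_I]] bilinear_rsub[OF bil[OF UNIV_I]]
  bilinear_lmul[OF bil[OF UNIV_I]] bilinear_rmul[OF bil[OF UNIV_I]]
  bilinear_lzero[OF bil[OF UNIV_I]] bilinear_rzero[OF bil[OF UNIV_I]]
lemmas \<gamma>_simps = bilinear_ladd[OF conn_bil[OF UNIV_I]] bilinear_radd[OF conn_bil[OF UNIV_I]]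
  bilinear_lmul[OF conn_bil[OF UNIV_I]] bilinear_rmul[OF conn_bil[OF UNIV_I]]

lemma fiber_block_sym: "fiber_block p i u v = fiber_block p i v u"
  using sym by (simp add: fiber_block_def)

lemma fiber_block_bilinear: "bilinear (fiber_block p i)"
  by (auto simp: bilinear_def fiber_block_def g_simps algebra_simps intro!: linearI)

lemma fiber_block_warped_conn:
  assumes "p \<in> region"
  shows "fiber_block p i (warped_conn p e u) v =
    log_deriv i (fst p) * (fst e * fiber_block p i u v + fst u * fiber_block p i e v)
    + (h i (fst p))\<^sup>2 * g (snd p $ i) (\<gamma> (snd p $ i) (snd e $ i) (snd u $ i)) (snd v $ i)"
  by (simp add: fiber_block_def warped_conn_def g_simps algebra_simps)

lemma log_deriv_has_derivative:
  assumes "s \<in> I"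
  shows "(log_deriv i has_real_derivative h'' i s / h i s - (log_deriv i s)\<^sup>2) (at s)"
proof -
  have "((\<lambda>s. h' i s / h i s) has_real_derivative h'' i s / h i s - (h' i s / h i s)\<^sup>2) (at s)"
    by (rule derivative_eq_intros h_deriv h'_deriv assms refl)+
       (use h_pos[OF assms, of i] in \<open>simp_all add: field_simps power2_eq_square\<close>)
  then show ?thesis by (simp add: log_deriv_def[abs_def])
qed

text \<open>
  A single block is not parallel. Its covariant derivative mixes it with the radial direction, and
  this defect, the term in the last line, is what the divergence below consists of. It cancels
  against the defect of the radial block when all blocks are added up to the metric.
\<close>
lemma fiber_block_deriv:
  assumes p: "p \<in> region"
  shows "((\<lambda>p. fiber_block p i u v) has_derivative
    (\<lambda>e. fiber_block p i (warped_conn p e u) v + fiber_block p i u (warped_conn p e v)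
       - log_deriv i (fst p) * (fst u * fiber_block p i e v + fst v * fiber_block p i e u))) (at p)"
proof -
  have s: "fst p \<in> I" using p by auto
  have hH: "h' i (fst p) = log_deriv i (fst p) * h i (fst p)"
    using h_pos[OF s, of i] by (simp add: log_deriv_def)
  show ?thesis
    unfolding fiber_block_sym[of p i u "warped_conn _ _ _"] fiber_block_warped_conn[OF p]
    unfolding fiber_block_def power2_eq_square
    by (rule derivative_eq_intros refl has_derivative_fst_compose[OF h_deriv[OF s]]
         has_derivative_fiber_compose[OF compat[OF UNIV_I]])+
       (simp add: fun_eq_iff hH sym[OF UNIV_I, of _ _ "\<gamma> _ _ _"] sym[OF UNIV_I, of _ "snd v $ i" "snd u $ i"]
         algebra_simps)
qed

lemma warped_conn_deriv:
  assumes p: "p \<in> region"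
  shows "((\<lambda>p. warped_conn p u w) has_derivative (\<lambda>e.
     (- (\<Sum>i\<in>UNIV. log_deriv i (fst p) * (fiber_block p i (warped_conn p e u) w + fiber_block p i u (warped_conn p e w)
           - log_deriv i (fst p) * (fst u * fiber_block p i e w + fst w * fiber_block p i e u))
         + (h'' i (fst p) / h i (fst p) - (log_deriv i (fst p))\<^sup>2) * fst e * fiber_block p i u w),
      \<chi> i. ((h'' i (fst p) / h i (fst p) - (log_deriv i (fst p))\<^sup>2) * fst e) *\<^sub>R (fst u *\<^sub>R snd w $ i + fst w *\<^sub>R snd u $ i)
           + D\<gamma> (snd p $ i) (snd e $ i) (snd u $ i) (snd w $ i)))) (at p)"
proof -
  have s: "fst p \<in> I" using p by auto
  show ?thesis
    unfolding warped_conn_def[of _ u w]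
    by (rule has_derivative_Pair has_derivative_vec_lambda has_derivative_minus has_derivative_sum has_derivative_mult
        has_derivative_add has_derivative_scaleR_left has_derivative_fst_compose[OF log_deriv_has_derivative[OF s]]
        fiber_block_deriv[OF p] has_derivative_fiber_compose[OF conn_deriv])+
qed

sublocale warped: levi_civita region warped_metric warped_conn
proof
  show "open region" using open_I by (simp add: open_Times)
  fix p assume p: "p \<in> region"
  then have s: "fst p \<in> I" by auto
  show "bilinear (warped_metric p)"
    unfolding bilinear_def
    by (intro conjI allI linearI) (simp_all add: warped_metric_def bilinear_ladd[OF fiber_block_bilinear] bilinear_radd[OF fiber_block_bilinear]
       bilinear_lmul[OF fiber_block_bilinear] bilinear_rmul[OF fiber_block_bilinear] 
       algebra_simps sum.distrib sum_distrib_left)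
  show "bilinear (warped_conn p)"
    unfolding bilinear_def
    by (intro conjI allI linearI) (simp_all add: warped_conn_def prod_eq_iff vec_eq_iff bilinear_ladd[OF fiber_block_bilinear] bilinear_radd[OF fiber_block_bilinear]
       bilinear_lmul[OF fiber_block_bilinear] bilinear_rmul[OF fiber_block_bilinear] \<gamma>_simps
       algebra_simps sum.distrib sum_distrib_left sum_negf)
  fix u v
  show "warped_metric p u v = warped_metric p v u"
    by (simp add: warped_metric_def fiber_block_sym[of p _ u v])
  show "warped_conn p u v = warped_conn p v u"
    using conn_sym by (simp add: warped_conn_def fiber_block_sym[of p _ u v] add.commute)
  show "warped_metric p u u > 0" if "u \<noteq> 0"
  proof -
    have ge: "fiber_block p i u u \<ge> 0" for i
      using pos[of "snd p $ i" "snd u $ i"] by (cases "snd u $ i = 0") (auto simp: fiber_block_def g_simps)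
    show ?thesis
    proof (cases "fst u = 0")
      case True
      then have "snd u \<noteq> 0" using that by (simp add: prod_eq_iff)
      then obtain i where "snd u $ i \<noteq> 0" by (auto simp: vec_eq_iff)
      then have "fiber_block p i u u > 0"
        using pos[of "snd p $ i" "snd u $ i"] h_pos[OF s, of i] by (simp add: fiber_block_def)
      then have "(\<Sum>i\<in>UNIV. fiber_block p i u u) > 0"
        by (intro sum_pos2[of _ i]) (use ge in auto)
      then show ?thesis using True by (simp add: warped_metric_def)
    next
      case False
      then show ?thesis using sum_nonneg[of UNIV "\<lambda>i. fiber_block p i u u"] ge
        by (simp add: warped_metric_def add_pos_nonneg flip: power2_eq_square)
    qed
  qed
  show "((\<lambda>p. warped_metric p u v) has_derivative (\<lambda>e. warped_metric p (warped_conn p e u) v + warped_metric p u (warped_conn p e v))) (at p)"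
    unfolding warped_metric_def
    by (rule derivative_eq_intros refl fiber_block_deriv[OF p])+
       (simp add: fun_eq_iff warped_conn_def sum.distrib sum_subtractf sum_distrib_left sum_distrib_right algebra_simps)
qed

text \<open>
  These are the sectional curvatures of a multiply warped product. The radial entry \<open>None, None\<close> is
  a default value, as the radial direction spans no plane.
\<close>
definition curv_coeff :: "real \<Rightarrow> 'k option \<Rightarrow> 'k option \<Rightarrow> real" where
  "curv_coeff s \<alpha> \<beta> =
     (case (\<alpha>, \<beta>) of
        (None, None) \<Rightarrow> 0
      | (None, Some i) \<Rightarrow> - (h'' i s / h i s)
      | (Some i, None) \<Rightarrow> - (h'' i s / h i s)
      | (Some i, Some j) \<Rightarrow> (if i = j then \<kappa> / (h i s)\<^sup>2 else 0) - log_deriv i s * log_deriv j s)"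

lemma block_simps [simp]:
  "block p None u v = fst u * fst v" "block p (Some i) u v = fiber_block p i u v"
  by (simp_all add: block_def)

text \<open>
  The radial and the fiber components of the curvature operator are computed separately. In the
  radial one everything cancels except the terms with \<open>h'' / h\<close>. In the fiber one the curvature of
  the fiber supplies the terms with \<open>\<kappa>\<close>, the radial derivative of the connection again those with
  \<open>h'' / h\<close>, and the second fundamental forms the products of logarithmic derivatives.
\<close>
lemma Rm_block:
  assumes p: "p \<in> region"
  shows "Rm warped_metric p u v w z = block_tensor (block p) (curv_coeff (fst p)) u v w z"
proof -
  define A where "A = (\<lambda>i. h'' i (fst p) / h i (fst p))"
  define \<eta> where "\<eta> = (\<lambda>i. log_deriv i (fst p))"
  define Q where "Q = fiber_block p"
  define \<Gamma> where "\<Gamma> = warped_conn p"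
  define D where "D = (\<lambda>e u.
     (- (\<Sum>i\<in>UNIV. \<eta> i * (Q i (\<Gamma> e u) w + Q i u (\<Gamma> e w) - \<eta> i * (fst u * Q i e w + fst w * Q i e u))
         + (A i - (\<eta> i)\<^sup>2) * fst e * Q i u w),
      \<chi> i. ((A i - (\<eta> i)\<^sup>2) * fst e) *\<^sub>R (fst u *\<^sub>R snd w $ i + fst w *\<^sub>R snd u $ i)
           + D\<gamma> (snd p $ i) (snd e $ i) (snd u $ i) (snd w $ i)))"
  have D: "((\<lambda>p. warped_conn p u w) has_derivative (\<lambda>e. D e u)) (at p)" for u
    using warped_conn_deriv[OF p, of u w] by (simp add: D_def A_def \<eta>_def Q_def \<Gamma>_def)
  define X where "X = D v u + \<Gamma> v (\<Gamma> u w) - (D u v + \<Gamma> u (\<Gamma> v w))"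
  have Qsym: "Q i u v = Q i v u" for i u v
    by (simp add: Q_def fiber_block_sym[of p i u v])
  have \<Gamma>: "\<Gamma> u v = (- (\<Sum>i\<in>UNIV. \<eta> i * Q i u v),
      \<chi> i. \<eta> i *\<^sub>R (fst u *\<^sub>R snd v $ i + fst v *\<^sub>R snd u $ i)
           + \<gamma> (snd p $ i) (snd u $ i) (snd v $ i))" for u v
    by (simp add: \<Gamma>_def warped_conn_def \<eta>_def Q_def)
  have X_fst: "fst X = - (\<Sum>i\<in>UNIV. A i * (fst v * Q i u w - fst u * Q i v w))"
  proof -
    have "fst X = - (\<Sum>i\<in>UNIV. \<eta> i * (Q i (\<Gamma> v u) w + Q i u (\<Gamma> v w) - \<eta> i * (fst u * Q i v w + fst w * Q i v u))
         + (A i - (\<eta> i)\<^sup>2) * fst v * Q i u w + \<eta> i * Q i v (\<Gamma> u w)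
         - (\<eta> i * (Q i (\<Gamma> u v) w + Q i v (\<Gamma> u w) - \<eta> i * (fst v * Q i u w + fst w * Q i u v))
         + (A i - (\<eta> i)\<^sup>2) * fst u * Q i v w + \<eta> i * Q i u (\<Gamma> v w)))"
      by (simp add: X_def D_def \<Gamma>[of v "\<Gamma> u w"] \<Gamma>[of u "\<Gamma> v w"] sum.distrib sum_subtractf)
    also have "\<dots> = - (\<Sum>i\<in>UNIV. A i * (fst v * Q i u w - fst u * Q i v w))"
      unfolding Qsym[of _ v u] warped.conn_sym[OF p, of v u, folded \<Gamma>_def]
      by (simp add: algebra_simps power2_eq_square)
    finally show ?thesis .
  qed
  have X_snd: "snd X $ i = \<kappa> *\<^sub>R (g (snd p $ i) (snd u $ i) (snd w $ i) *\<^sub>R snd v $ i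
        - g (snd p $ i) (snd v $ i) (snd w $ i) *\<^sub>R snd u $ i)
      + (A i * fst w) *\<^sub>R (fst v *\<^sub>R snd u $ i - fst u *\<^sub>R snd v $ i)
      - (\<eta> i * (\<Sum>j\<in>UNIV. \<eta> j * Q j u w)) *\<^sub>R snd v $ i
      + (\<eta> i * (\<Sum>j\<in>UNIV. \<eta> j * Q j v w)) *\<^sub>R snd u $ i" for i
  proof -
    note curv = constant_curvature[of "snd p $ i" "snd v $ i" "snd u $ i" "snd w $ i"]
    have sm: "\<gamma> (snd p $ i) (snd v $ i) (snd u $ i) = \<gamma> (snd p $ i) (snd u $ i) (snd v $ i)"
      by (rule conn_sym) simp
    show ?thesis
      unfolding curv[symmetric]
      by (simp add: X_def D_def \<Gamma> \<gamma>_simps sm algebra_simps power2_eq_square)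
  qed
  have Q_X: "Q i X z = \<kappa> / (h i (fst p))\<^sup>2 * (Q i u w * Q i v z - Q i v w * Q i u z)
      + A i * fst w * (fst v * Q i u z - fst u * Q i v z)
      - \<eta> i * (\<Sum>j\<in>UNIV. \<eta> j * Q j u w) * Q i v z + \<eta> i * (\<Sum>j\<in>UNIV. \<eta> j * Q j v w) * Q i u z" for i
  proof -
    have "h i (fst p) \<noteq> 0" using p h_pos[of "fst p" i] by auto
    then show ?thesis
      by (simp add: Q_def fiber_block_def X_snd g_simps)
         (simp add: field_simps power2_eq_square)
  qed
  have "Rm warped_metric p u v w z = warped_metric p X z"
    unfolding warped.Rm_eq[OF p D D] by (simp add: X_def \<Gamma>_def)
  also have "\<dots> = fst X * fst z + (\<Sum>i\<in>UNIV. Q i X z)"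
    by (simp add: warped_metric_def Q_def)
  also have "\<dots> = block_tensor (block p) (curv_coeff (fst p)) u v w z"
    unfolding Q_X X_fst block_tensor_def sum_UNIV_option
    by (simp add: curv_coeff_def A_def[symmetric] \<eta>_def[symmetric] Q_def[symmetric]
        A_def[symmetric, THEN fun_cong] \<eta>_def[symmetric, THEN fun_cong]
        algebra_simps sum.distrib sum_subtractf sum_distrib_left sum_distrib_right 
        if_distrib[of "\<lambda>c. c * _"] if_distrib[of "\<lambda>c. _ * c"] sum_negf cong: if_cong)
       (* the two indices of the products of logarithmic derivatives come in opposite order *)
       (subst sum.swap, simp add: mult_ac)
  finally show ?thesis .
qed

definition block_dim :: "'k option \<Rightarrow> real" where
  "block_dim \<alpha> = (case \<alpha> of None \<Rightarrow> 1 | Some i \<Rightarrow> real DIM('e))"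

lemma metric_trace_warped_metric:
  assumes p: "p \<in> region"
  shows "metric_trace warped_metric p B = B (1, 0) (1, 0)
     + (\<Sum>i\<in>UNIV. \<Sum>b\<in>Basis. B (0, axis i b) (0, axis i b) / ((h i (fst p))\<^sup>2 * \<phi> (snd p $ i)))"
proof -
  have axis_nth: "axis i b $ j = (if j = i then b else 0)" for i j and b :: 'e
    by (simp add: axis_def)
  have "warped_metric p a b = 0" if "a \<in> Basis" "b \<in> Basis" "a \<noteq> b" for a b
    using that
    by (auto simp: Basis_prod_def Basis_vec_def warped_metric_def fiber_block_def axis_nth conformal inner_Basis intro!: sum.neutral)
  then have "metric_trace warped_metric p B = (\<Sum>a\<in>Basis. B a a / warped_metric p a a)"
    by (intro metric_trace_orthogonal warped.bil[OF p] warped.pos[OF p])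
  also have "\<dots> = B (1, 0) (1, 0) / warped_metric p (1, 0) (1, 0)
      + (\<Sum>i\<in>UNIV. \<Sum>b\<in>Basis. B (0, axis i b) (0, axis i b) / warped_metric p (0, axis i b) (0, axis i b))"
    by (simp add: sum_Basis_prod sum_Basis_vec)
  also have "\<dots> = B (1, 0) (1, 0)
     + (\<Sum>i\<in>UNIV. \<Sum>b\<in>Basis. B (0, axis i b) (0, axis i b) / ((h i (fst p))\<^sup>2 * \<phi> (snd p $ i)))"
  proof -
    have "warped_metric p (0, axis i b) (0, axis i b) = (h i (fst p))\<^sup>2 * \<phi> (snd p $ i)" if "b \<in> Basis" for i b
    proof -
      have "fiber_block p j (0, axis i b) (0, axis i b) = (if j = i then (h i (fst p))\<^sup>2 * \<phi> (snd p $ i) else 0)" for j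
        using that by (simp add: fiber_block_def axis_nth conformal inner_Basis)
      then show ?thesis by (simp add: warped_metric_def)
    qed
    moreover have "warped_metric p (1, 0) (1, 0) = 1"
      by (simp add: warped_metric_def fiber_block_def conformal)
    ultimately show ?thesis by simp
  qed
  finally show ?thesis .
qed

lemma orthogonal_blocks:
  assumes p: "p \<in> region"
  shows "orthogonal_blocks warped_metric p (block p) block_dim"
proof
  fix \<alpha> \<beta> u v
  have axis_nth: "axis i b $ j = (if j = i then b else 0)" for i j and b :: 'e
    by (simp add: axis_def)
  have hp: "h i (fst p) \<noteq> 0" for i using p h_pos[of "fst p" i] by auto
  have \<phi>p: "\<phi> x \<noteq> 0" for x using conformal_factor_pos[of x] by simp
  note [simp] = hp \<phi>p
  show "block p \<alpha> u v = block p \<alpha> v u"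
    by (cases \<alpha>) (simp_all add: fiber_block_sym[of p _ u v])
  show "warped_metric p u v = (\<Sum>\<alpha>\<in>UNIV. block p \<alpha> u v)"
    by (simp add: sum_UNIV_option warped_metric_def)
  show "metric_trace warped_metric p (\<lambda>a b. block p \<alpha> a b) = block_dim \<alpha>"
  proof (cases \<alpha>)
    case None
    then show ?thesis by (simp add: metric_trace_warped_metric[OF p] block_dim_def)
  next
    case (Some k)
    have "metric_trace warped_metric p (\<lambda>a b. block p \<alpha> a b)
       = (\<Sum>i\<in>UNIV. \<Sum>b\<in>(Basis::'e set). if i = k then 1 else 0)"
      unfolding metric_trace_warped_metric[OF p] Some
      by (simp add: fiber_block_def conformal axis_nth) (auto intro!: sum.cong simp: inner_Basis)
    also have "\<dots> = block_dim \<alpha>"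
      by (simp add: block_dim_def Some if_distrib[of "\<lambda>c. _ * c"] cong: if_cong)
    finally show ?thesis .
  qed
  show "metric_trace warped_metric p (\<lambda>a b. block p \<alpha> a u * block p \<beta> b v) = (if \<alpha> = \<beta> then block p \<alpha> u v else 0)"
  proof (cases \<alpha>; cases \<beta>)
    fix k l assume kl: "\<alpha> = Some k" "\<beta> = Some l"
    have "metric_trace warped_metric p (\<lambda>a b. block p \<alpha> a u * block p \<beta> b v)
       = (\<Sum>i\<in>UNIV. if i = k \<and> i = l then (\<Sum>b\<in>Basis. (h i (fst p))\<^sup>2 * \<phi> (snd p $ i) * ((b \<bullet> snd u $ i) * (b \<bullet> snd v $ i))) else 0)"
      unfolding metric_trace_warped_metric[OF p] kl
      by (simp add: fiber_block_def conformal axis_nth)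
         (auto intro!: sum.cong sum.neutral simp: field_simps power2_eq_square)
    also have "\<dots> = (\<Sum>i\<in>UNIV. if i = k \<and> i = l then fiber_block p i u v else 0)"
      by (intro sum.cong refl if_cong)
         (simp add: fiber_block_def conformal sum_distrib_left[symmetric] euclidean_inner[of "snd u $ _" "snd v $ _"] inner_commute)
    also have "\<dots> = (if \<alpha> = \<beta> then block p \<alpha> u v else 0)"
      by (cases "k = l") (auto simp: kl intro!: sum.neutral)
    finally show ?thesis .
  qed (auto simp: metric_trace_warped_metric[OF p] fiber_block_def conformal axis_nth)
qed

lemma Weyl_block:
  assumes p: "p \<in> region"
  shows "Weyl warped_metric p u v w z =
    block_tensor (block p) (weyl_coeff (1 + real (CARD('k) * DIM('e))) block_dim (curv_coeff (fst p))) u v w z"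
  using orthogonal_blocks.Weyl_block[OF orthogonal_blocks[OF p] Rm_block[OF p]] by simp

text \<open>
  Minus the covariant derivative of \<open>fiber_block p i\<close> in direction \<open>e\<close>, by \<open>fiber_block_deriv\<close>.
\<close>
definition fiber_shear :: "real \<times> ('e ^ 'k) \<Rightarrow> 'k \<Rightarrow> real \<times> ('e ^ 'k) \<Rightarrow> real \<times> ('e ^ 'k) \<Rightarrow> real \<times> ('e ^ 'k) \<Rightarrow> real" where
  "fiber_shear p i e u v = log_deriv i (fst p) * (fst u * fiber_block p i e v + fst v * fiber_block p i e u)"

text \<open>
  The Leibniz rule. The Christoffel terms in the derivatives of the blocks are exactly those
  subtracted by \<open>nabla_tensor4\<close>, so only the shears survive.
\<close>
lemma nabla_fiber_tensor:
  assumes p: "p \<in> region"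
    and W: "\<And>p u v w z. p \<in> region \<Longrightarrow> W p u v w z = block_tensor (fiber_block p) (\<lambda>i j. \<omega> i j (fst p)) u v w z"
    and \<omega>: "\<And>i j. (\<omega> i j has_real_derivative \<omega>' i j) (at (fst p))"
  shows "nabla_tensor4 warped_metric W p e u v w z =
    (\<Sum>i\<in>UNIV. \<Sum>j\<in>UNIV.
      \<omega>' i j * fst e * (fiber_block p i u w * fiber_block p j v z - fiber_block p i u z * fiber_block p j v w)
      - \<omega> i j (fst p) *
        (fiber_shear p i e u w * fiber_block p j v z + fiber_block p i u w * fiber_shear p j e v z
         - fiber_shear p i e u z * fiber_block p j v w - fiber_block p i u z * fiber_shear p j e v w))"
proof -
  define Q where "Q = fiber_block p"
  define \<Gamma> where "\<Gamma> = warped_conn p"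
  define dQ where "dQ = (\<lambda>i u v e. Q i (\<Gamma> e u) v + Q i u (\<Gamma> e v) - fiber_shear p i e u v)"
  have dQ: "((\<lambda>p. fiber_block p i u v) has_derivative dQ i u v) (at p)" for i u v
    using fiber_block_deriv[OF p, of i u v] by (simp add: dQ_def Q_def \<Gamma>_def fiber_shear_def)
  define dW where "dW = (\<lambda>e. \<Sum>i\<in>UNIV. \<Sum>j\<in>UNIV.
      \<omega> i j (fst p) * (Q i u w * dQ j v z e + dQ i u w e * Q j v z - (Q i u z * dQ j v w e + dQ i u z e * Q j v w))
      + \<omega>' i j * fst e * (Q i u w * Q j v z - Q i u z * Q j v w))"
  have "((\<lambda>p. block_tensor (fiber_block p) (\<lambda>i j. \<omega> i j (fst p)) u v w z) has_derivative dW) (at p)"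
    unfolding block_tensor_def dW_def Q_def
    by (rule has_derivative_sum has_derivative_mult has_derivative_diff dQ
        has_derivative_fst_compose[OF \<omega>])+
  then have "((\<lambda>p. W p u v w z) has_derivative dW) (at p)"
    by (rule has_derivative_transform_within_open[OF _ warped.open_S p]) (simp add: W)
  then have fd: "frechet_derivative (\<lambda>p. W p u v w z) (at p) = dW"
    using frechet_derivative_at by metis
  show ?thesis
    unfolding nabla_tensor4_def fd warped.christoffel_eq[OF p] W[OF p] block_tensor_def dW_def dQ_def
      Q_def[symmetric] \<Gamma>_def[symmetric] sum_subtractf[symmetric]
    by (intro sum.cong refl) (simp add: algebra_simps)
qed

text \<open>
  For a tensor without radial components, the derivatives \<open>\<omega>'\<close> of the coefficients drop out of the
  divergence, because they come with the radial component of the contracted index. What remains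
  are the shears. Therefore harmonicity is an algebraic condition on \<open>\<omega>\<close>, to be checked at one
  parameter at a time: \<open>DIM('e) * (\<Sum>i. \<omega> i j * log_deriv i) = \<omega> j j * log_deriv j\<close> for all \<open>j\<close>. For a
  trace-free tensor this says \<open>(\<Sum>i. \<omega> i j * (log_deriv i - log_deriv j)) = 0\<close>.
\<close>
lemma div_fiber_tensor:
  assumes p: "p \<in> region"
    and W: "\<And>p u v w z. p \<in> region \<Longrightarrow> W p u v w z = block_tensor (fiber_block p) (\<lambda>i j. \<omega> i j (fst p)) u v w z"
    and \<omega>: "\<And>i j. \<omega> i j differentiable (at (fst p))"
  shows "metric_trace warped_metric p (\<lambda>a b. nabla_tensor4 warped_metric W p a b v w z) =
    (\<Sum>j\<in>UNIV. (\<omega> j j (fst p) * log_deriv j (fst p) - real DIM('e) * (\<Sum>i\<in>UNIV. \<omega> i j (fst p) * log_deriv i (fst p)))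
       * (fst w * fiber_block p j v z - fst z * fiber_block p j v w))"
proof -
  interpret orthogonal_blocks warped_metric p "block p" block_dim
    by (rule orthogonal_blocks[OF p])
  define Q where "Q = fiber_block p"
  define \<eta> where "\<eta> i = log_deriv i (fst p)" for i
  define T where "T = metric_trace warped_metric p"
  let ?\<omega> = "\<lambda>i j. \<omega> i j (fst p)"
  obtain \<omega>' where \<omega>': "\<And>i j. (\<omega> i j has_real_derivative \<omega>' i j) (at (fst p))"
    using \<omega> unfolding real_differentiable_def by metis
  have Qsym: "Q i u v = Q i v u" for i u v
    by (simp add: Q_def fiber_block_sym[of p i u v])
  have T1: "T (\<lambda>a b. fst a * Q i b u) = 0" for i u
    using trace_block_mult[of None "(1,0)" "Some i" u] by (simp add: T_def Q_def)
  have T2: "T (\<lambda>a b. fst b * Q i a u) = 0" for i u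
    using trace_block_mult[of "Some i" u None "(1,0)"] by (simp add: T_def Q_def mult.commute)
  have T3: "T (\<lambda>a b. Q i a b) = real DIM('e)" for i
    using trace_block[of "Some i"] by (simp add: T_def Q_def block_dim_def)
  have T4: "T (\<lambda>a b. Q i b u * Q j a v) = (if i = j then Q i u v else 0)" for i j u v
    using trace_block_mult[of "Some j" v "Some i" u] Qsym[of j v u]
    by (auto simp: T_def Q_def mult.commute)
  note T_linear = metric_trace_add metric_trace_diff metric_trace_cmult
  have Tij: "T (\<lambda>a b. \<omega>' i j * fst a * (Q i b w * Q j v z - Q i b z * Q j v w)
      - ?\<omega> i j * (\<eta> i * (fst b * Q i a w + fst w * Q i a b) * Q j v z + Q i b w * (\<eta> j * (fst v * Q j a z + fst z * Q j a v))
         - \<eta> i * (fst b * Q i a z + fst z * Q i a b) * Q j v w - Q i b z * (\<eta> j * (fst v * Q j a w + fst w * Q j a v))))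
      = - (real DIM('e) * (?\<omega> i j * \<eta> i) * (fst w * Q j v z - fst z * Q j v w))
        + (if i = j then ?\<omega> j j * \<eta> j * (fst w * Q j v z - fst z * Q j v w) else 0)" (is "T ?F = _") for i j
  proof -
    have "?F = (\<lambda>a b. (\<omega>' i j * Q j v z) * (fst a * Q i b w) - (\<omega>' i j * Q j v w) * (fst a * Q i b z)
       - (?\<omega> i j * \<eta> i * Q j v z) * (fst b * Q i a w) + (?\<omega> i j * \<eta> i * Q j v w) * (fst b * Q i a z)
       - (?\<omega> i j * \<eta> i * (fst w * Q j v z - fst z * Q j v w)) * Q i a b
       - (?\<omega> i j * \<eta> j * fst v) * (Q i b w * Q j a z) - (?\<omega> i j * \<eta> j * fst z) * (Q i b w * Q j a v)
       + (?\<omega> i j * \<eta> j * fst v) * (Q i b z * Q j a w) + (?\<omega> i j * \<eta> j * fst w) * (Q i b z * Q j a v))"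
      by (simp add: fun_eq_iff algebra_simps)
    then have "T ?F = - (?\<omega> i j * \<eta> i * (fst w * Q j v z - fst z * Q j v w)) * real DIM('e)
       - (?\<omega> i j * \<eta> j * fst v) * (if i = j then Q i w z else 0) - (?\<omega> i j * \<eta> j * fst z) * (if i = j then Q i w v else 0)
       + (?\<omega> i j * \<eta> j * fst v) * (if i = j then Q i z w else 0) + (?\<omega> i j * \<eta> j * fst w) * (if i = j then Q i z v else 0)"
      by (simp only: T_def T_linear T1[unfolded T_def] T2[unfolded T_def] T3[unfolded T_def] T4[unfolded T_def]) simp
    then show ?thesis
      using Qsym[of j w z] Qsym[of j w v] Qsym[of j z v] by (auto simp: algebra_simps)
  qed
  have "metric_trace warped_metric p (\<lambda>a b. nabla_tensor4 warped_metric W p a b v w z) =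
     (\<Sum>i\<in>UNIV. \<Sum>j\<in>UNIV. - (real DIM('e) * (?\<omega> i j * \<eta> i) * (fst w * Q j v z - fst z * Q j v w))
        + (if i = j then ?\<omega> j j * \<eta> j * (fst w * Q j v z - fst z * Q j v w) else 0))"
    by (subst nabla_fiber_tensor[of p W \<omega> \<omega>', OF p W \<omega>'], assumption)
       (simp only: metric_trace_sum fiber_shear_def Tij[unfolded T_def Q_def \<eta>_def] Q_def \<eta>_def)
  also have "\<dots> = (\<Sum>j\<in>UNIV. \<Sum>i\<in>UNIV. - (real DIM('e) * (?\<omega> i j * \<eta> i) * (fst w * Q j v z - fst z * Q j v w))
        + (if i = j then ?\<omega> j j * \<eta> j * (fst w * Q j v z - fst z * Q j v w) else 0))"
    by (rule sum.swap)
  also have "\<dots> = (\<Sum>j\<in>UNIV. (?\<omega> j j * \<eta> j - real DIM('e) * (\<Sum>i\<in>UNIV. ?\<omega> i j * \<eta> i)) * (fst w * Q j v z - fst z * Q j v w))"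
  proof -
    have "(\<Sum>i\<in>UNIV. - (d * a i * X) + (if i = j then c * X else 0)) = (c - d * (\<Sum>i\<in>UNIV. a i)) * X"
      for d c X :: real and a :: "'k \<Rightarrow> real" and j
      by (simp add: sum.distrib sum_negf sum_subtractf sum_distrib_left sum_distrib_right left_diff_distrib)
    then show ?thesis by simp
  qed
  finally show ?thesis by (simp add: Q_def \<eta>_def)
qed

lemma fiber_block_fiber_vec:
  "fiber_block p k (fiber_vec i u) v = (if k = i then (h i (fst p))\<^sup>2 * g (snd p $ i) u (snd v $ i) else 0)"
  by (simp add: fiber_block_def fiber_vec_def axis_def g_simps)

lemma warped_metric_fiber_vec: "warped_metric p (fiber_vec i u) v = fiber_block p i (fiber_vec i u) v"
proof -
  have "warped_metric p (fiber_vec i u) v = (\<Sum>k\<in>UNIV. if k = i then fiber_block p i (fiber_vec i u) v else 0)"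
    unfolding warped_metric_def
    by (simp add: fiber_block_fiber_vec) (simp add: fiber_vec_def)
  then show ?thesis by simp
qed

lemma fiber_tensor_mixed:
  assumes ij: "i \<noteq> j" and U: "warped_metric p (fiber_vec i u) (fiber_vec i u) = 1"
    and V: "warped_metric p (fiber_vec j v) (fiber_vec j v) = 1"
  shows "block_tensor (fiber_block p) w (fiber_vec i u) (fiber_vec j v) (fiber_vec i u) (fiber_vec j v) = w i j"
proof -
  have zero: "fiber_block p l (fiber_vec k x) y = 0" if "l \<noteq> k" for k l x y
    using that by (simp add: fiber_block_fiber_vec)
  have mixed: "fiber_block p k (fiber_vec i u) (fiber_vec j v) = 0" for k
    using ij zero[of k i u] zero[of k j v] fiber_block_sym[of p k "fiber_vec j v"] by (cases "k = i") auto
  have "w k l * (fiber_block p k (fiber_vec i u) (fiber_vec i u) * fiber_block p l (fiber_vec j v) (fiber_vec j v))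
      = (if l = j then if k = i then w i j else 0 else 0)" for k l
    using U V by (auto simp: warped_metric_fiber_vec zero)
  then show ?thesis
    by (simp add: block_tensor_def mixed)
qed

lemma ex_unit_fiber_vec:
  assumes p: "p \<in> region"
  shows "\<exists>u. warped_metric p (fiber_vec i u) (fiber_vec i u) = 1"
proof -
  obtain b :: 'e where b: "b \<in> Basis" using nonempty_Basis by blast
  define m where "m = (h i (fst p))\<^sup>2 * \<phi> (snd p $ i)"
  have "m > 0"
    using p h_pos[of "fst p" i] conformal_factor_pos by (auto simp: m_def)
  then have "warped_metric p (fiber_vec i ((1 / sqrt m) *\<^sub>R b)) (fiber_vec i ((1 / sqrt m) *\<^sub>R b)) = m * ((1 / sqrt m)\<^sup>2)"
    using b by (simp add: warped_metric_fiber_vec fiber_block_fiber_vec) 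
      (simp add: fiber_vec_def axis_def conformal m_def power2_eq_square)
  then show ?thesis
    using \<open>m > 0\<close> by (auto simp: power_divide)
qed

end

section \<open>Three warping functions\<close>

definition warp :: "3 \<Rightarrow> real \<Rightarrow> real" where
  "warp i t = (if i = 1 then t * (1 + t) else if i = 2 then 1 + t else t)"

definition warp' :: "3 \<Rightarrow> real \<Rightarrow> real" where
  "warp' i t = (if i = 1 then 1 + 2 * t else 1)"

definition warp'' :: "3 \<Rightarrow> real \<Rightarrow> real" where
  "warp'' i t = (if i = 1 then 2 else 0)"

text \<open>
  The vanishing of the radial Weyl components forces this value: the radial Weyl coefficients of the
  three fibers agree precisely if the fibers have Einstein constant \<open>2 * r - 1\<close>.
\<close>
definition fiber_curv :: "real \<Rightarrow> real" where
  "fiber_curv r = (2 * r - 1) / (r - 1)"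

text \<open>
  The Weyl coefficients between the fibers. The diagonal entries follow from the others because the
  Weyl tensor is trace-free.
\<close>
definition fiber_weyl :: "real \<Rightarrow> 3 \<Rightarrow> 3 \<Rightarrow> real \<Rightarrow> real" where
  "fiber_weyl r i j t =
     (if i = j then r / ((r - 1) * (warp i t)\<^sup>2)
      else if i \<noteq> 3 \<and> j \<noteq> 3 then 1 / (t * (1 + t)\<^sup>2)
      else if i \<noteq> 2 \<and> j \<noteq> 2 then - 1 / (t\<^sup>2 * (1 + t))
      else - 1 / (t * (1 + t)))"

lemma three_distinct [simp]: "(1::3) \<noteq> 2" "(2::3) \<noteq> 1" "(1::3) \<noteq> 3" "(3::3) \<noteq> 1" "(2::3) \<noteq> 3" "(3::3) \<noteq> 2"
  by simp_all

lemma warp_pos: "t > 0 \<Longrightarrow> warp i t > 0"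
  by (simp add: warp_def)

lemma warp_deriv: "(warp i has_real_derivative warp' i t) (at t)"
  by (cases "i = 1"; cases "i = 2") (auto simp: warp_def[abs_def] warp'_def intro!: derivative_eq_intros)

lemma warp'_deriv: "(warp' i has_real_derivative warp'' i t) (at t)"
  by (auto simp: warp'_def[abs_def] warp''_def intro!: derivative_eq_intros)

lemma smooth_warp: "smooth_on {0<..} (warp i)"
proof -
  have id: "Ck_on k {0<..} (\<lambda>t::real. t)" for k
    by (rule Ck_on_bounded_linear) simp_all
  have "Ck_on k {0<..} (\<lambda>t::real. t * (1 + t))" "Ck_on k {0<..} (\<lambda>t::real. 1 + t)" for k
    by (intro Ck_on_mult Ck_on_add Ck_on_const id open_greaterThan)+
  then show ?thesis
    using id by (cases "i = 1"; cases "i = 2") (auto simp: smooth_on_def warp_def[abs_def])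
qed

text \<open>
  The sign pattern: positive between the first two fibers, negative between each of them and the third.
\<close>
lemma fiber_weyl_mixed:
  assumes t: "t > 0"
  shows "i \<noteq> j \<Longrightarrow> fiber_weyl r i j t \<noteq> 0" "fiber_weyl r 1 2 t > 0" "fiber_weyl r 1 3 t < 0"
  using t by (auto simp: fiber_weyl_def divide_less_0_iff mult_less_0_iff)

lemma deriv_warp: "deriv (warp i) t = warp' i t"
  by (rule DERIV_imp_deriv[OF warp_deriv])

lemma log_deriv_distinct:
  assumes "t > 0" "i \<noteq> j"
  shows "deriv (warp i) t / warp i t \<noteq> deriv (warp j) t / warp j t"
proof -
  have "1 + (t * t + t * 2) \<noteq> 0"
    using mult_pos_pos[OF assms(1) assms(1)] assms(1) by linarith
  then show ?thesis
    using assms exhaust_3[of i] exhaust_3[of j]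
    by (auto simp: deriv_warp warp_def warp'_def field_simps)
qed

text \<open>
  The fibers may live in any Euclidean space of dimension \<open>r\<close>. The real number \<open>r\<close> keeps the
  dimension from reappearing as a cast in every rational function below.
\<close>
locale spherical_triple =
  fixes E :: "'e::euclidean_space itself" and r :: real
  assumes DIM_eq: "real DIM('e) = r" and r_ge_2: "r \<ge> 2"
begin

lemma fiber_curv_pos: "fiber_curv r > 0"
  using r_ge_2 by (simp add: fiber_curv_def)

sublocale warped_space_forms "sph_metric (1 / fiber_curv r) :: 'e metric_field" sph_conn sph_conn_deriv
  "\<lambda>x. (1 / fiber_curv r) * (sph_factor x)\<^sup>2" "fiber_curv r" "{0<..}" warp warp' warp''
proof -
  interpret conformal_space_form "sph_metric (1 / fiber_curv r) :: 'e metric_field" sph_conn sph_conn_deriv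
    "\<lambda>x. (1 / fiber_curv r) * (sph_factor x)\<^sup>2" "fiber_curv r"
    using sphere_space_form[of "1 / fiber_curv r"] fiber_curv_pos by simp
  show "warped_space_forms (sph_metric (1 / fiber_curv r) :: 'e metric_field) sph_conn sph_conn_deriv
     (\<lambda>x. (1 / fiber_curv r) * (sph_factor x)\<^sup>2) (fiber_curv r) {0<..} warp warp' warp''"
    by unfold_locales (auto simp: warp_pos warp_deriv warp'_deriv)
qed

lemma curv_values:
  "curv_coeff t None None = 0"
  "curv_coeff t None (Some i) = - (warp'' i t / warp i t)"
  "curv_coeff t (Some i) None = - (warp'' i t / warp i t)"
  "curv_coeff t (Some i) (Some j) = (if i = j then (2 * r - 1) / (r - 1) / (warp i t)\<^sup>2 else 0)
     - warp' i t / warp i t * (warp' j t / warp j t)"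
  by (simp_all add: curv_coeff_def log_deriv_def, simp_all add: fiber_curv_def)

text \<open>
  The fiber curvature cancels the squares of the logarithmic derivatives up to multiples of
  \<open>1 / (t * (1 + t)) = 1 / t - 1 / (1 + t)\<close>, by the choice of \<open>fiber_curv\<close>.
\<close>
lemma ricci_values:
  assumes t: "t > 0"
  shows "ricci_coeff block_dim (curv_coeff t) None = - (2 * r) / (t * (1 + t))"
    and "ricci_coeff block_dim (curv_coeff t) (Some i) = (if i = 1 then 2 - 8 * r else - (2 * r)) / (t * (1 + t))"
proof -
  have nz: "r - 1 \<noteq> 0" "2 * r - 1 \<noteq> 0" "t \<noteq> 0" "1 + t \<noteq> 0" using r_ge_2 t by auto
  show "ricci_coeff block_dim (curv_coeff t) None = - (2 * r) / (t * (1 + t))"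
    using nz by (simp add: ricci_coeff_def sum_UNIV_option sum_3 block_dim_def DIM_eq curv_values warp_def warp''_def)
  show "ricci_coeff block_dim (curv_coeff t) (Some i) = (if i = 1 then 2 - 8 * r else - (2 * r)) / (t * (1 + t))"
    using exhaust_3[of i] nz
    by (auto simp: ricci_coeff_def sum_UNIV_option sum_3 block_dim_def DIM_eq curv_values warp_def warp'_def warp''_def)
       (simp_all add: divide_simps, simp_all add: algebra_simps power2_eq_square)
qed

lemma scalar_value:
  assumes t: "t > 0"
  shows "scalar_coeff block_dim (curv_coeff t) = - (12 * r\<^sup>2) / (t * (1 + t))"
proof -
  have "t \<noteq> 0" "1 + t \<noteq> 0" using t by auto
  then show ?thesis
    unfolding scalar_coeff_def sum_UNIV_option sum_3 ricci_values[OF t]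
    by (simp add: block_dim_def DIM_eq divide_simps) (simp add: algebra_simps power2_eq_square)
qed

lemma weyl_values:
  assumes t: "t > 0"
  shows "weyl_coeff (1 + 3 * r) block_dim (curv_coeff t) None (Some i) = 0"
    and "weyl_coeff (1 + 3 * r) block_dim (curv_coeff t) (Some i) None = 0"
    and "weyl_coeff (1 + 3 * r) block_dim (curv_coeff t) (Some i) (Some j) = fiber_weyl r i j t"
proof -
  have nz: "r - 1 \<noteq> 0" "2 * r - 1 \<noteq> 0" "3 * r - 1 \<noteq> 0" "r \<noteq> 0" "t \<noteq> 0" "1 + t \<noteq> 0" using r_ge_2 t by auto
  show "weyl_coeff (1 + 3 * r) block_dim (curv_coeff t) None (Some i) = 0"
    using exhaust_3[of i] nz
    by (auto simp: weyl_coeff_def ricci_values[OF t] scalar_value[OF t] curv_values warp_def warp''_def)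
       (simp_all add: divide_simps, simp_all add: algebra_simps power2_eq_square)
  show "weyl_coeff (1 + 3 * r) block_dim (curv_coeff t) (Some i) None = 0"
    using exhaust_3[of i] nz
    by (auto simp: weyl_coeff_def ricci_values[OF t] scalar_value[OF t] curv_values warp_def warp''_def)
       (simp_all add: divide_simps, simp_all add: algebra_simps power2_eq_square)
  show "weyl_coeff (1 + 3 * r) block_dim (curv_coeff t) (Some i) (Some j) = fiber_weyl r i j t"
    using exhaust_3[of i] exhaust_3[of j] nz
    by (auto simp: weyl_coeff_def ricci_values[OF t] scalar_value[OF t] curv_values fiber_weyl_def warp_def warp'_def)
       (simp_all add: divide_simps, simp_all add: algebra_simps power2_eq_square)
qed

lemma Weyl_warped_metric:
  assumes p: "p \<in> region"
  shows "Weyl warped_metric p u v w z = block_tensor (fiber_block p) (\<lambda>i j. fiber_weyl r i j (fst p)) u v w z"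
proof -
  have t: "fst p > 0" using p by auto
  show ?thesis
    unfolding Weyl_block[OF p] block_tensor_def sum_UNIV_option
    by (simp add: DIM_eq weyl_values[OF t])
qed

lemma div_Weyl_warped_metric:
  assumes p: "p \<in> region"
  shows "div_Weyl warped_metric p v w z = 0"
proof -
  have t: "fst p > 0" using p by auto
  have nz: "r - 1 \<noteq> 0" "fst p \<noteq> 0" "1 + fst p \<noteq> 0" using r_ge_2 t by auto
  have "fiber_weyl r i j differentiable at (fst p)" for i j
    using exhaust_3[of i] exhaust_3[of j] nz
    by (auto simp: fiber_weyl_def[abs_def] warp_def intro!: derivative_intros)
  moreover have "fiber_weyl r j j (fst p) * log_deriv j (fst p) - r * (\<Sum>i\<in>UNIV. fiber_weyl r i j (fst p) * log_deriv i (fst p)) = 0" for j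
    using exhaust_3[of j] nz
    by (auto simp: fiber_weyl_def sum_3 log_deriv_def warp_def warp'_def)
       (simp_all add: divide_simps, simp_all add: algebra_simps power2_eq_square)
  ultimately show ?thesis
    unfolding div_Weyl_def by (subst div_fiber_tensor[OF p Weyl_warped_metric]) (simp_all add: DIM_eq)
qed

section \<open>The total space\<close>

abbreviation fibers :: "3 \<Rightarrow> (nat, 'e, 'e) riem_mfd" where
  "fibers \<equiv> (\<lambda>_. sph_manifold (1 / fiber_curv r))"

abbreviation total :: "(3 \<Rightarrow> nat, real \<times> (3 \<Rightarrow> 'e), real \<times> ('e ^ 3)) riem_mfd" where
  "total \<equiv> multiply_warped_product {0<..} warp fibers"

text \<open>
  Two parameters suffice: \<open>warp i 2 / warp i 1\<close> is \<open>3\<close>, \<open>3 / 2\<close> and \<open>2\<close> for the three fibers.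
\<close>
lemma warp_nonproportional:
  assumes "i \<noteq> j"
  shows "\<not> (\<exists>c>0. \<forall>s\<in>{0<..}. warp i s = c * warp j s)"
proof
  assume "\<exists>c>0. \<forall>s\<in>{0<..}. warp i s = c * warp j s"
  then obtain c where c: "\<forall>s\<in>{0<..}. warp i s = c * warp j s" by blast
  have "warp i 1 = c * warp j 1" "warp i 2 = c * warp j 2"
    using bspec[OF c, of 1] bspec[OF c, of 2] by simp_all
  then show False
    using assms exhaust_3[of i] exhaust_3[of j] by (auto simp: warp_def)
qed

lemma warped_product_data_fibers: "warped_product_data {0<..} warp fibers"
proof -
  have "{0::real<..} \<noteq> {}" by (metis greaterThan_non_empty)
  then show ?thesis
    using fiber_curv_pos warp_nonproportional
    by (simp add: warped_product_data_def smooth_warp warp_pos connected_sph_manifold connected_Ioi)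
qed

lemma einstein_fibers: "einstein (fibers i)"
  unfolding einstein_def
  by (rule exI[of _ "(r - 1) * fiber_curv r"]) (simp add: sph_manifold_def Ric_space_form DIM_eq)

lemma cmetric_total: "cmetric total c = warped_metric"
  by (auto simp: fun_eq_iff multiply_warped_product_def warped_metric_def fiber_block_def sph_manifold_def)

lemma cimg_total: "cimg total c \<subseteq> region"
  by (auto simp: cimg_def multiply_warped_product_def)

lemma harmonic_total: "harmonic_Weyl total"
  unfolding harmonic_Weyl_def cmetric_total using cimg_total div_Weyl_warped_metric by blast

lemma zero_radial_total: "zero_radial_Weyl total"
proof -
  have "Weyl warped_metric p d_s v w z = 0" if "p \<in> region" for p v w z
    by (simp add: Weyl_warped_metric[OF that] block_tensor_def fiber_block_def d_s_def g_simps)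
  then show ?thesis
    unfolding zero_radial_Weyl_def cmetric_total using cimg_total by blast
qed

text \<open>
  Unit vectors exist in every fiber, so the set of components is exactly the set of off-diagonal
  coefficients.
\<close>
lemma mixed_Weyl_total:
  assumes p: "p \<in> region"
  shows "mixed_Weyl_components total c p = {fiber_weyl r i j (fst p) | i j. i \<noteq> j}"
proof -
  have *: "Weyl warped_metric p (fiber_vec i u) (fiber_vec j v) (fiber_vec i u) (fiber_vec j v) = fiber_weyl r i j (fst p)"
    if "i \<noteq> j" "warped_metric p (fiber_vec i u) (fiber_vec i u) = 1" "warped_metric p (fiber_vec j v) (fiber_vec j v) = 1" for i j u v
    using that by (simp add: Weyl_warped_metric[OF p] fiber_tensor_mixed)
  show ?thesis
    unfolding mixed_Weyl_components_def cmetric_total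
  proof (intro equalityI subsetI)
    fix y assume "y \<in> {fiber_weyl r i j (fst p) | i j. i \<noteq> j}"
    then obtain i j where y: "i \<noteq> j" "y = fiber_weyl r i j (fst p)" by blast
    obtain u v where uv: "warped_metric p (fiber_vec i u) (fiber_vec i u) = 1" "warped_metric p (fiber_vec j v) (fiber_vec j v) = 1"
      using ex_unit_fiber_vec[OF p] by metis
    show "y \<in> {Weyl warped_metric p U V U V | U V. \<exists>i j u v. i \<noteq> j \<and> U = fiber_vec i u \<and> V = fiber_vec j v \<and>
        warped_metric p U U = 1 \<and> warped_metric p V V = 1}"
      by (rule CollectI, rule exI[of _ "fiber_vec i u"], rule exI[of _ "fiber_vec j v"])
         (use y uv *[OF y(1) uv] in \<open>intro conjI exI[of _ i] exI[of _ j] exI[of _ u] exI[of _ v]; simp\<close>)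
  next
    fix y assume "y \<in> {Weyl warped_metric p U V U V | U V. \<exists>i j u v. i \<noteq> j \<and> U = fiber_vec i u \<and> V = fiber_vec j v \<and>
        warped_metric p U U = 1 \<and> warped_metric p V V = 1}"
    then show "y \<in> {fiber_weyl r i j (fst p) | i j. i \<noteq> j}"
      using * by blast
  qed
qed

end

theorem theorem2:
  fixes r :: nat
  assumes "r \<ge> 2" and "CARD('r::finite) = r"
  shows "\<exists>(I :: real set) (h :: 3 \<Rightarrow> real \<Rightarrow> real)
            (N :: 3 \<Rightarrow> (nat, real ^ 'r, real ^ 'r) riem_mfd)
            (M :: (3 \<Rightarrow> nat, real \<times> (3 \<Rightarrow> real ^ 'r), real \<times> ((real ^ 'r) ^ 3)) riem_mfd).
     warped_product_data I h N \<and>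
     M = multiply_warped_product I h N \<and>
     (\<forall>i. einstein (N i)) \<and>
     harmonic_Weyl M \<and>
     zero_radial_Weyl M \<and>
     (\<forall>i. \<forall>s\<in>I. deriv (h i) s \<noteq> 0) \<and>
     (\<forall>s\<in>I. \<forall>i j. i \<noteq> j \<longrightarrow> deriv (h i) s / h i s \<noteq> deriv (h j) s / h j s) \<and>
     (\<forall>c\<in>cidx M. \<forall>x\<in>cimg M c.
        (\<forall>y\<in>mixed_Weyl_components M c x. y \<noteq> 0) \<and>
        (\<exists>y\<in>mixed_Weyl_components M c x. y > 0) \<and>
        (\<exists>y\<in>mixed_Weyl_components M c x. y < 0))"
proof -
  interpret spherical_triple "TYPE(real ^ 'r)" "real r"
    by unfold_locales (use assms in simp_all)
  have "deriv (warp i) s \<noteq> 0" if "s > 0" for i s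
    using that by (simp add: deriv_warp warp'_def)
  moreover have "(\<forall>y\<in>mixed_Weyl_components total c x. y \<noteq> 0) \<and>
        (\<exists>y\<in>mixed_Weyl_components total c x. y > 0) \<and> (\<exists>y\<in>mixed_Weyl_components total c x. y < 0)"
    if "x \<in> cimg total c" for c x
  proof -
    have x: "x \<in> region" using that cimg_total by blast
    then have t: "fst x > 0" by auto
    have ex: "fiber_weyl (real r) 1 2 (fst x) \<in> mixed_Weyl_components total c x"
      "fiber_weyl (real r) 1 3 (fst x) \<in> mixed_Weyl_components total c x"
      unfolding mixed_Weyl_total[OF x] using three_distinct by blast+
    have "\<forall>y\<in>mixed_Weyl_components total c x. y \<noteq> 0"
      using fiber_weyl_mixed(1)[OF t] by (auto simp: mixed_Weyl_total[OF x])
    then show ?thesis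
      using ex fiber_weyl_mixed(2,3)[OF t] by blast
  qed
  ultimately show ?thesis
    using warped_product_data_fibers einstein_fibers harmonic_total zero_radial_total log_deriv_distinct
    by (intro exI[of _ "{0<..}"] exI[of _ warp] exI[of _ fibers] exI[of _ total]) auto
qed

end
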